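(* Let $X$ be a non-ergodic Banach space with an unconditional basis. Let $A$ be (the closed linear span of) an element of the residual class of isomorphism in $bb_d(X)$, i.e. $A=[x]$ where $x\in bb_d(X)$ is such that $\{y\in bb_d(X): [y]\simeq[x]\}$ is residual in $bb_d(X)$. Then for every block-subspace $Y$ of $X$, $A\simeq A\oplus Y$. If moreover $X$ is hereditarily block-minimal, then all residual classes in $bb_d(Y)$, for block-subspaces $Y$ of $X$, are isomorphic; that is, if $Y,Z$ are block-subspaces of $X$ and $B=[u]$, $C=[v]$ with $u$ in the residual class of isomorphism in $bb_d(Y)$ and $v$ in the residual class of isomorphism in $bb_d(Z)$, then $B\simeq C$.
   Context: Spaces are infinite-dimensional; $\simeq$ denotes linear isomorphism, $[y]$ the closed linear span of a sequence $y$. $X$ has basis $\{e_i\}$. A block-sequence is a sequence of norm-one finitely supported vectors $(y_i)$ with $\max\mathrm{supp}(y_i)<\min\mathrm{supp}(y_{i+1})$; a block-subspace is the closed linear span of an infinite block-sequence, which serves as its basis. Let $\mathbf{Q}$ be the countable set of normalized finitely supported vectors that are scalar multiples of a vector with rational coordinates on the basis (coordinates in $\mathbb{Q}+i\mathbb{Q}$ in the complex case). $bb_d(X)$ is the set of infinite block-sequences of vectors in $\mathbf{Q}$, with the product of the discrete topology on $\mathbf{Q}$ (a Polish space). For a block-subspace $Y$ of $X$, $bb_d(Y)$ is defined similarly with respect to the block basis of $Y$. "Residual" means comeagre. If a space with a basis is non-ergodic, then there is a (unique) isomorphism class which is residual, i.e. a residual set of the form $\{y\in bb_d: [y]\simeq[x]\}$;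 this is "the residual class of isomorphism". $X$ is block-minimal if every block-subspace of $X$ has a further block-subspace isomorphic to $X$; it is hereditarily block-minimal if each of its block-subspaces is block-minimal. $\mathcal{B}_X$ is the set of closed linear subspaces of $X$ with its Effros-Borel structure (generated by the sets $\{F : F\cap U\neq\emptyset\}$, $U\subset X$ open). $E_0$ is the relation on $2^\omega$ of eventual agreement of binary sequences. $X$ is ergodic if there is a Borel map $f:2^\omega\to\mathcal{B}_X$ such that $\alpha E_0\beta$ if and only if $f(\alpha)\simeq f(\beta)$. *)

theory Defs
  imports "HOL-Analysis.Analysis"
begin

section \<open>Real or complex Banach spaces\<close>

text \<open>
  The axiom says that the scalars are \<open>\<real>\<close> (\<open>j = 0\<close>) or \<open>\<real> + \<real>j\<close> with \<open>j\<^sup>2 = -1\<close>.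
\<close>

class real_or_complex = real_normed_field +
  assumes ex_imaginary_unit:
    "\<exists>j. (j = 0 \<or> j * j = - 1) \<and> (\<forall>x. \<exists>a b. x = a *\<^sub>R 1 + b *\<^sub>R j)"

instance real :: real_or_complex
proof
  show "\<exists>j. (j = 0 \<or> j * j = - 1) \<and> (\<forall>x::real. \<exists>a b. x = a *\<^sub>R 1 + b *\<^sub>R j)"
    by (intro exI[of _ 0]) auto
qed

instance complex :: real_or_complex
proof
  have "\<exists>a b. x = a *\<^sub>R 1 + b *\<^sub>R \<i>" for x
    by (rule exI[of _ "Re x"], rule exI[of _ "Im x"]) (simp add: complex_eq_iff)
  then show "\<exists>j. (j = 0 \<or> j * j = - 1) \<and> (\<forall>x::complex. \<exists>a b. x = a *\<^sub>R 1 + b *\<^sub>R j)"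
    by (intro exI[of _ \<i>] conjI allI) simp_all
qed

definition rational_scalars :: "'k::real_or_complex set" where
  "rational_scalars = {of_rat p + of_rat q * j | p q j. j = 0 \<or> j * j = - 1}"

lemma rational_scalars_real: "(rational_scalars :: real set) = \<rat>"
proof -
  have "j * j \<noteq> - 1" for j :: real
    using zero_le_square[of j] by linarith
  then have "rational_scalars = {of_rat p + of_rat q * j | p q (j::real). j = 0}"
    unfolding rational_scalars_def by simp
  also have "\<dots> = range of_rat"
    by auto
  finally show ?thesis
    by (simp add: Rats_def)
qed

lemma rational_scalars_complex:
  "x \<in> rational_scalars \<longleftrightarrow> (\<exists>p q. x = of_rat p + of_rat q * \<i>)"
proof
  assume "x \<in> rational_scalars"
  then obtain p q j where x: "x = of_rat p + of_rat q * j" and j: "j = 0 \<or> j * j = - 1"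
    unfolding rational_scalars_def by blast
  have "j = 0 \<or> j = \<i> \<or> j = - \<i>"
    using j power2_eq_iff[of j \<i>] by (auto simp: power2_eq_square)
  then consider "x = of_rat p + of_rat 0 * \<i>" | "x = of_rat p + of_rat q * \<i>"
    | "x = of_rat p + of_rat (- q) * \<i>"
    using x by (auto simp: of_rat_minus)
  then show "\<exists>p q. x = of_rat p + of_rat q * \<i>"
    by cases (rule exI, rule exI, assumption)+
next
  assume "\<exists>p q. x = of_rat p + of_rat q * \<i>"
  then obtain p q where x: "x = of_rat p + of_rat q * \<i>"
    by (elim exE)
  show "x \<in> rational_scalars"
    unfolding rational_scalars_def
    by (rule CollectI, rule exI[of _ p], rule exI[of _ q], rule exI[of _ \<i>]) (simp add: x)
qed

text \<open>
  A Banach space over \<open>'k\<close> is a type of class \<^class>\<open>banach\<close> together with a compatible scalar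
  multiplication \<open>sc\<close> by elements of \<open>'k\<close>.
\<close>

locale banach_over = vector_space sc
  for sc :: "'k::real_or_complex \<Rightarrow> 'a::banach \<Rightarrow> 'a" +
  assumes scale_real: "sc (r *\<^sub>R 1) x = r *\<^sub>R x"
    and norm_scale: "norm (sc c x) = norm c * norm x"

lemma banach_over_scaleR: "banach_over (scaleR :: real \<Rightarrow> 'a::banach \<Rightarrow> 'a)"
  by unfold_locales (simp_all add: scaleR_add_left scaleR_add_right)

lemma banach_over_complex: "banach_over ((*) :: complex \<Rightarrow> complex \<Rightarrow> complex)"
  by unfold_locales (simp_all add: distrib_left distrib_right norm_mult)

definition closed_subspaces ::
    "('k::real_or_complex \<Rightarrow> 'a::banach \<Rightarrow> 'a) \<Rightarrow> 'a set set" where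
  "closed_subspaces sc = {F. module.subspace sc F \<and> closed F}"

definition closed_span ::
    "('k::real_or_complex \<Rightarrow> 'a::banach \<Rightarrow> 'a) \<Rightarrow> (nat \<Rightarrow> 'a) \<Rightarrow> 'a set" where
  "closed_span sc y = closure (module.span sc (range y))"

text \<open>
  The two scalar multiplications are explicit because the subspaces being compared may live in
  different spaces, such as \<open>X\<close> and \<open>X \<times> X\<close>.
\<close>

definition lin_isomorphic ::
    "('k::real_or_complex \<Rightarrow> 'a::banach \<Rightarrow> 'a) \<Rightarrow> 'a set \<Rightarrow>
     ('k \<Rightarrow> 'b::banach \<Rightarrow> 'b) \<Rightarrow> 'b set \<Rightarrow> bool" where
  "lin_isomorphic s1 S s2 T \<longleftrightarrow>
     (\<exists>f g. homeomorphism S T f g \<and>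
        (\<forall>x\<in>S. \<forall>y\<in>S. f (x + y) = f x + f y) \<and>
        (\<forall>c. \<forall>x\<in>S. f (s1 c x) = s2 c (f x)))"


section \<open>Bases and block-sequences\<close>

definition schauder_basis ::
    "('k::real_or_complex \<Rightarrow> 'a::banach \<Rightarrow> 'a) \<Rightarrow> (nat \<Rightarrow> 'a) \<Rightarrow> bool" where
  "schauder_basis sc e \<longleftrightarrow> (\<forall>x. \<exists>!a. (\<lambda>i. sc (a i) (e i)) sums x)"

text \<open>
  \<^const>\<open>has_sum\<close> is convergence along the net of finite sets of indices, i.e.\ unconditional
  convergence.
\<close>

definition unconditional_basis ::
    "('k::real_or_complex \<Rightarrow> 'a::banach \<Rightarrow> 'a) \<Rightarrow> (nat \<Rightarrow> 'a) \<Rightarrow> bool" where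
  "unconditional_basis sc e \<longleftrightarrow>
     schauder_basis sc e \<and>
     (\<forall>a x. (\<lambda>i. sc (a i) (e i)) sums x \<longrightarrow> ((\<lambda>i. sc (a i) (e i)) has_sum x) UNIV)"

text \<open>
  In what follows \<open>e\<close> is a basis of \<open>closed_span sc e\<close>: either the basis of the whole space, or a
  block-sequence serving as the basis of a block-subspace. Coordinates and supports are
  meaningful for elements of \<open>closed_span sc e\<close> only.
\<close>

definition coords ::
    "('k::real_or_complex \<Rightarrow> 'a::banach \<Rightarrow> 'a) \<Rightarrow> (nat \<Rightarrow> 'a) \<Rightarrow> 'a \<Rightarrow> nat \<Rightarrow> 'k" where
  "coords sc e x = (THE a. (\<lambda>i. sc (a i) (e i)) sums x)"

definition supp ::
    "('k::real_or_complex \<Rightarrow> 'a::banach \<Rightarrow> 'a) \<Rightarrow> (nat \<Rightarrow> 'a) \<Rightarrow> 'a \<Rightarrow> nat set" where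
  "supp sc e x = {i. coords sc e x i \<noteq> 0}"

definition finitely_supported ::
    "('k::real_or_complex \<Rightarrow> 'a::banach \<Rightarrow> 'a) \<Rightarrow> (nat \<Rightarrow> 'a) \<Rightarrow> 'a set" where
  "finitely_supported sc e = {x \<in> closed_span sc e. finite (supp sc e x)}"

definition block_sequence ::
    "('k::real_or_complex \<Rightarrow> 'a::banach \<Rightarrow> 'a) \<Rightarrow> (nat \<Rightarrow> 'a) \<Rightarrow> (nat \<Rightarrow> 'a) \<Rightarrow> bool" where
  "block_sequence sc e y \<longleftrightarrow>
     (\<forall>i. norm (y i) = 1 \<and> y i \<in> finitely_supported sc e \<and>
          Max (supp sc e (y i)) < Min (supp sc e (y (Suc i))))"

text \<open>
  Normalized multiples of rational vectors. The multiple is taken with a real factor; for real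
  scalars this is no restriction, and for complex scalars it makes the set countable (arbitrary
  unimodular factors would not).
\<close>

definition rational_blocks ::
    "('k::real_or_complex \<Rightarrow> 'a::banach \<Rightarrow> 'a) \<Rightarrow> (nat \<Rightarrow> 'a) \<Rightarrow> 'a set" where
  "rational_blocks sc e =
     {x \<in> finitely_supported sc e. norm x = 1 \<and>
        (\<exists>r::real. \<exists>z \<in> finitely_supported sc e.
           (\<forall>i. coords sc e z i \<in> rational_scalars) \<and> x = r *\<^sub>R z)}"

definition bbd ::
    "('k::real_or_complex \<Rightarrow> 'a::banach \<Rightarrow> 'a) \<Rightarrow> (nat \<Rightarrow> 'a) \<Rightarrow> (nat \<Rightarrow> 'a) set" where
  "bbd sc e = {y. block_sequence sc e y \<and> (\<forall>i. y i \<in> rational_blocks sc e)}"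

definition bbd_topology ::
    "('k::real_or_complex \<Rightarrow> 'a::banach \<Rightarrow> 'a) \<Rightarrow> (nat \<Rightarrow> 'a) \<Rightarrow> (nat \<Rightarrow> 'a) topology" where
  "bbd_topology sc e =
     subtopology (product_topology (\<lambda>_. discrete_topology (rational_blocks sc e)) UNIV)
       (bbd sc e)"


section \<open>Baire category\<close>

definition nowhere_dense_in :: "'a topology \<Rightarrow> 'a set \<Rightarrow> bool" where
  "nowhere_dense_in T S \<longleftrightarrow> S \<subseteq> topspace T \<and> T interior_of (T closure_of S) = {}"

definition meagre_in :: "'a topology \<Rightarrow> 'a set \<Rightarrow> bool" where
  "meagre_in T S \<longleftrightarrow> (\<exists>N :: nat \<Rightarrow> 'a set. (\<forall>n. nowhere_dense_in T (N n)) \<and> S = (\<Union>n. N n))"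

definition comeagre_in :: "'a topology \<Rightarrow> 'a set \<Rightarrow> bool" where
  "comeagre_in T S \<longleftrightarrow> S \<subseteq> topspace T \<and> meagre_in T (topspace T - S)"

definition in_residual_class ::
    "('k::real_or_complex \<Rightarrow> 'a::banach \<Rightarrow> 'a) \<Rightarrow> (nat \<Rightarrow> 'a) \<Rightarrow> (nat \<Rightarrow> 'a) \<Rightarrow> bool" where
  "in_residual_class sc e x \<longleftrightarrow>
     x \<in> bbd sc e \<and>
     comeagre_in (bbd_topology sc e)
       {y \<in> bbd sc e. lin_isomorphic sc (closed_span sc y) sc (closed_span sc x)}"


section \<open>Minimality\<close>

definition block_minimal ::
    "('k::real_or_complex \<Rightarrow> 'a::banach \<Rightarrow> 'a) \<Rightarrow> (nat \<Rightarrow> 'a) \<Rightarrow> bool" where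
  "block_minimal sc e \<longleftrightarrow>
     (\<forall>y. block_sequence sc e y \<longrightarrow>
        (\<exists>z. block_sequence sc y z \<and>
             lin_isomorphic sc (closed_span sc z) sc (closed_span sc e)))"

definition hereditarily_block_minimal ::
    "('k::real_or_complex \<Rightarrow> 'a::banach \<Rightarrow> 'a) \<Rightarrow> (nat \<Rightarrow> 'a) \<Rightarrow> bool" where
  "hereditarily_block_minimal sc e \<longleftrightarrow> (\<forall>y. block_sequence sc e y \<longrightarrow> block_minimal sc y)"


section \<open>Ergodicity\<close>

definition effros_borel :: "('k::real_or_complex \<Rightarrow> 'a::banach \<Rightarrow> 'a) \<Rightarrow> 'a set measure" where
  "effros_borel sc =
     sigma (closed_subspaces sc) {{F \<in> closed_subspaces sc. F \<inter> U \<noteq> {}} | U. open U}"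

definition E0 :: "(nat \<Rightarrow> bool) \<Rightarrow> (nat \<Rightarrow> bool) \<Rightarrow> bool" where
  "E0 \<alpha> \<beta> \<longleftrightarrow> (\<exists>m. \<forall>n\<ge>m. \<alpha> n = \<beta> n)"

definition ergodic :: "('k::real_or_complex \<Rightarrow> 'a::banach \<Rightarrow> 'a) \<Rightarrow> bool" where
  "ergodic sc \<longleftrightarrow>
     (\<exists>f \<in> borel \<rightarrow>\<^sub>M effros_borel sc.
        \<forall>\<alpha> \<beta>. E0 \<alpha> \<beta> \<longleftrightarrow> lin_isomorphic sc (f \<alpha>) sc (f \<beta>))"

end

theory Submission
  imports Defs
begin

text \<open>
  Write \<open>A = [x]\<close> for \<open>x\<close> in the residual class, and let \<open>N j\<close> be the nowhere dense sets that cover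
  the block-sequences spanning a space not isomorphic to \<open>A\<close>. The first part rests on one category
  construction (\<open>generic_pieces\<close>). Given a rational block-sequence \<open>w\<close>, it cuts the indices into
  consecutive intervals and chooses for the \<open>k\<close>-th interval a finite rational block string \<open>t k\<close> that
  occupies the same stretch of the basis as the vectors of \<open>w\<close> there. The \<open>k\<close>-th string is chosen so
  that appending it to any of the strings built so far avoids \<open>N 0, \<dots>, N k\<close>. Hence any sequence that
  uses \<open>t k\<close> on infinitely many intervals, and on each other interval either the vectors of \<open>w\<close> or
  nothing, spans a copy of \<open>A\<close>.

  Using \<open>t k\<close> on the even intervals only, and then also \<open>w\<close> on the odd ones, gives copies of \<open>A\<close>
  spanned by \<open>T\<close> and by \<open>T \<union> W\<close>, where \<open>W\<close> is the odd half of \<open>w\<close>. Unconditionality splits the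
  second as a direct sum, so \<open>A \<simeq> A \<oplus> [W]\<close>. Exchanging the parities gives the same for the even half
  of \<open>w\<close>, and absorbing both halves in turn yields \<open>A \<simeq> A \<oplus> [w]\<close> (\<open>residual_class_absorbs\<close>). An
  arbitrary block-sequence is a small perturbation of a rational one (\<open>bbd_lin_isomorphic\<close>).

  For the second part, let \<open>B\<close> and \<open>C\<close> be spanned by elements of the residual classes in the
  block-subspaces \<open>[y]\<close> and \<open>[z]\<close>. Apply the first part inside \<open>[y]\<close>: if \<open>C\<close> is
  isomorphic to a block-subspace of \<open>[y]\<close>, then \<open>B \<simeq> B \<oplus> C\<close>; by symmetry \<open>C \<simeq> C \<oplus> B\<close>, whence
  \<open>B \<simeq> C\<close>. To place \<open>C\<close> inside \<open>[y]\<close> (\<open>hereditarily_block_minimal_embeds\<close>), minimality of the whole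
  space embeds it linearly. A gliding hump then finds a block-subspace of \<open>C\<close> on which a perturbation
  of this embedding sends blocks to blocks, and minimality of \<open>C\<close> finds a copy of \<open>C\<close> inside it.

  All bases and block-sequences are handled through one quantitative notion, \<open>uncond\<close>: suppressing
  coordinates does not increase norms by more than a constant factor. For an unconditional basis it
  is obtained from Baire's theorem (\<open>unconditional_basis_uncond\<close>), and it passes to block-sequences
  with the same constant.
\<close>

section \<open>Scalars\<close>

text \<open>
  The product of \<open>a + b j\<close> with its conjugate is \<open>a\<^sup>2 + b\<^sup>2\<close>, which bounds both components by the norm.
  So the scalars carry the topology of \<open>\<real>\<close> or \<open>\<real>\<^sup>2\<close>, and completeness and density of the rational
  scalars can be checked on components.
\<close>

lemma imaginary_unit_components_bound:
  fixes j :: "'k::real_or_complex"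
  assumes "j * j = - 1"
  shows "norm j = 1" and "\<bar>a\<bar> + \<bar>b\<bar> \<le> 2 * norm (a *\<^sub>R 1 + b *\<^sub>R j)"
proof -
  have "norm j * norm j = 1"
    using arg_cong[OF assms, of norm] by (simp add: norm_mult)
  then show j1: "norm j = 1"
    using power2_eq_1_iff[of "norm j"] norm_ge_zero[of j] by (auto simp: power2_eq_square)
  let ?x = "a *\<^sub>R 1 + b *\<^sub>R j" and ?y = "a *\<^sub>R 1 - b *\<^sub>R j"
  have "?x * ?y = (a\<^sup>2 + b\<^sup>2) *\<^sub>R 1"
    using assms by (simp add: algebra_simps power2_eq_square)
  then have "norm ?x * norm ?y = norm ((a\<^sup>2 + b\<^sup>2) *\<^sub>R (1::'k))"
    by (simp only: norm_mult[symmetric])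
  then have prod: "norm ?x * norm ?y = a\<^sup>2 + b\<^sup>2"
    by simp
  have "norm ?y \<le> norm (a *\<^sub>R (1::'k)) + norm (b *\<^sub>R j)"
    by (rule norm_triangle_ineq4)
  then have y: "norm ?y \<le> \<bar>a\<bar> + \<bar>b\<bar>"
    by (simp add: j1)
  have "(\<bar>a\<bar> + \<bar>b\<bar>) * (\<bar>a\<bar> + \<bar>b\<bar>) \<le> 2 * (a\<^sup>2 + b\<^sup>2)"
    using zero_le_power2[of "\<bar>a\<bar> - \<bar>b\<bar>"] by (simp add: power2_eq_square algebra_simps)
  also have "\<dots> \<le> 2 * (norm ?x * (\<bar>a\<bar> + \<bar>b\<bar>))"
    unfolding prod[symmetric] using y by (intro mult_left_mono) auto
  finally have "(\<bar>a\<bar> + \<bar>b\<bar>) * (\<bar>a\<bar> + \<bar>b\<bar>) \<le> (2 * norm ?x) * (\<bar>a\<bar> + \<bar>b\<bar>)"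
    by simp
  then show "\<bar>a\<bar> + \<bar>b\<bar> \<le> 2 * norm ?x"
    using mult_right_le_imp_le norm_ge_zero[of ?x] by (smt (verit, best))
qed

lemma real_or_complex_components:
  obtains j :: "'k::real_or_complex" and a b :: "'k \<Rightarrow> real"
  where "j = 0 \<or> j * j = - 1" and "norm j \<le> 1" and "\<And>x. x = a x *\<^sub>R 1 + b x *\<^sub>R j"
    and "\<And>x y. \<bar>a x - a y\<bar> \<le> 2 * norm (x - y)" and "\<And>x y. \<bar>b x - b y\<bar> \<le> 2 * norm (x - y)"
proof -
  obtain j :: 'k where j: "j = 0 \<or> j * j = - 1" and "\<forall>x. \<exists>a b. x = a *\<^sub>R 1 + b *\<^sub>R j"
    using ex_imaginary_unit by blast
  then obtain a b where ab: "\<And>x. x = a x *\<^sub>R 1 + b x *\<^sub>R j"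
    by metis
  show thesis
  proof (cases "j = 0")
    case True
    have "\<bar>a x - a y\<bar> = norm (x - y)" for x y
    proof -
      have "x - y = (a x *\<^sub>R 1 + b x *\<^sub>R j) - (a y *\<^sub>R 1 + b y *\<^sub>R j)"
        by (rule arg_cong2[OF ab ab])
      also have "\<dots> = (a x - a y) *\<^sub>R 1"
        by (simp add: True algebra_simps)
      finally show ?thesis
        by simp
    qed
    moreover have "x = a x *\<^sub>R 1 + 0 *\<^sub>R j" for x
      by (rule trans[OF ab]) (simp add: True)
    ultimately show thesis
      using j True by (intro that[of j a "\<lambda>_. 0"]) auto
  next
    case False
    then have jj: "j * j = - 1"
      using j by simp
    have "\<bar>a x - a y\<bar> + \<bar>b x - b y\<bar> \<le> 2 * norm (x - y)" for x y
    proof -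
      have "x - y = (a x *\<^sub>R 1 + b x *\<^sub>R j) - (a y *\<^sub>R 1 + b y *\<^sub>R j)"
        by (rule arg_cong2[OF ab ab])
      also have "\<dots> = (a x - a y) *\<^sub>R 1 + (b x - b y) *\<^sub>R j"
        by (simp add: algebra_simps)
      finally show ?thesis
        using imaginary_unit_components_bound(2)[OF jj] by simp
    qed
    then have "\<bar>a x - a y\<bar> \<le> 2 * norm (x - y)" "\<bar>b x - b y\<bar> \<le> 2 * norm (x - y)" for x y
      by (smt (verit, best))+
    then show thesis
      using jj imaginary_unit_components_bound(1)[OF jj] by (intro that[of j a b, OF _ _ ab]) auto
  qed
qed

lemma scalar_Cauchy_convergent:
  fixes f :: "nat \<Rightarrow> 'k::real_or_complex"
  assumes "Cauchy f"
  shows "convergent f"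
proof -
  obtain j :: 'k and a b :: "'k \<Rightarrow> real"
    where ab: "\<And>x. x = a x *\<^sub>R 1 + b x *\<^sub>R j"
      and a: "\<And>x y. \<bar>a x - a y\<bar> \<le> 2 * norm (x - y)" and b: "\<And>x y. \<bar>b x - b y\<bar> \<le> 2 * norm (x - y)"
    by (rule real_or_complex_components) blast
  have conv: "convergent (\<lambda>n. h (f n))" if h: "\<And>x y. \<bar>h x - h y\<bar> \<le> 2 * norm (x - y)" for h :: "'k \<Rightarrow> real"
  proof -
    have "Cauchy (\<lambda>n. h (f n))"
    proof (rule CauchyI)
      fix \<epsilon> :: real
      assume "0 < \<epsilon>"
      then obtain M where M: "\<And>m n. m \<ge> M \<Longrightarrow> n \<ge> M \<Longrightarrow> norm (f m - f n) < \<epsilon> / 2"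
        using assms by (meson CauchyD half_gt_zero)
      have "norm (h (f m) - h (f n)) < \<epsilon>" if "m \<ge> M" "n \<ge> M" for m n
        using h[of "f m" "f n"] M[OF that] by simp
      then show "\<exists>M. \<forall>m\<ge>M. \<forall>n\<ge>M. norm (h (f m) - h (f n)) < \<epsilon>"
        by blast
    qed
    then show ?thesis
      by (simp add: Cauchy_convergent_iff)
  qed
  obtain p q where "(\<lambda>n. a (f n)) \<longlonglongrightarrow> p" "(\<lambda>n. b (f n)) \<longlonglongrightarrow> q"
    using conv[of a] conv[of b] a b by (auto simp: convergent_def)
  then have "(\<lambda>n. a (f n) *\<^sub>R 1 + b (f n) *\<^sub>R j) \<longlonglongrightarrow> p *\<^sub>R 1 + q *\<^sub>R j"
    by (intro tendsto_intros)
  then show ?thesis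
    unfolding ab[symmetric] by (rule convergentI)
qed

lemma rational_scalars_dense:
  fixes x :: "'k::real_or_complex"
  assumes "0 < \<epsilon>"
  shows "\<exists>q\<in>rational_scalars. norm (q - x) < \<epsilon>"
proof -
  obtain j :: 'k and a b where j: "j = 0 \<or> j * j = - 1" "norm j \<le> 1" and x: "x = a *\<^sub>R 1 + b *\<^sub>R j"
    by (rule real_or_complex_components) blast
  have near: "\<exists>r::rat. \<bar>of_rat r - c\<bar> < \<epsilon> / 2" for c :: real
  proof -
    obtain r where "c - \<epsilon> / 2 < of_rat r" "of_rat r < c + \<epsilon> / 2"
      using of_rat_dense[of "c - \<epsilon> / 2" "c + \<epsilon> / 2"] assms by auto
    then have "\<bar>of_rat r - c\<bar> < \<epsilon> / 2"
      by linarith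
    then show ?thesis ..
  qed
  obtain p q :: rat where p: "\<bar>of_rat p - a\<bar> < \<epsilon> / 2" and q: "\<bar>of_rat q - b\<bar> < \<epsilon> / 2"
    using near[of a] near[of b] by blast
  have rat: "of_rat r = (of_rat r :: real) *\<^sub>R (1::'k)" for r
    unfolding of_real_def[symmetric] by (cases r) (simp add: of_rat_rat)
  have "of_rat p + of_rat q * j - x = (of_rat p - a) *\<^sub>R 1 + (of_rat q - b) *\<^sub>R j"
    by (simp add: x rat[of p] rat[of q] algebra_simps)
  then have "norm (of_rat p + of_rat q * j - x) \<le> \<bar>of_rat p - a\<bar> + \<bar>of_rat q - b\<bar> * norm j"
    using norm_triangle_ineq[of "(of_rat p - a) *\<^sub>R (1::'k)" "(of_rat q - b) *\<^sub>R j"] by simp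
  also have "\<dots> < \<epsilon>"
    using p q mult_left_mono[OF j(2), of "\<bar>of_rat q - b\<bar>"] by simp
  finally show ?thesis
    unfolding rational_scalars_def using j(1) by blast
qed


section \<open>Linear isomorphisms\<close>

text \<open>
  The conditions are restricted to \<open>S\<close> because isomorphisms are given on subspaces only, and their
  perturbations are built from coordinates, which are meaningful on closed spans.
\<close>

definition linear_embedding ::
    "('k::real_or_complex \<Rightarrow> 'a::banach \<Rightarrow> 'a) \<Rightarrow> 'a set \<Rightarrow>
     ('k \<Rightarrow> 'b::banach \<Rightarrow> 'b) \<Rightarrow> ('a \<Rightarrow> 'b) \<Rightarrow> bool" where
  "linear_embedding s1 S s2 f \<longleftrightarrow>
     (\<forall>x\<in>S. \<forall>y\<in>S. f (x + y) = f x + f y) \<and>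
     (\<forall>c. \<forall>x\<in>S. f (s1 c x) = s2 c (f x)) \<and>
     (\<exists>m>0. \<forall>x\<in>S. m * norm x \<le> norm (f x)) \<and>
     (\<exists>M. \<forall>x\<in>S. norm (f x) \<le> M * norm x)"

lemma linear_embedding_subset:
  "linear_embedding s1 S s2 f \<Longrightarrow> T \<subseteq> S \<Longrightarrow> linear_embedding s1 T s2 f"
  unfolding linear_embedding_def by blast

lemma linear_embedding_diff:
  assumes f: "linear_embedding s1 S s2 f" and diff: "\<And>x y. x \<in> S \<Longrightarrow> y \<in> S \<Longrightarrow> x - y \<in> S"
    and "x \<in> S" "y \<in> S"
  shows "f (x - y) = f x - f y"
proof -
  have "f ((x - y) + y) = f (x - y) + f y"
    using f assms unfolding linear_embedding_def by blast
  then show ?thesis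
    by (simp add: algebra_simps)
qed

lemma linear_embedding_bounds:
  assumes f: "linear_embedding s1 S s2 f" and diff: "\<And>x y. x \<in> S \<Longrightarrow> y \<in> S \<Longrightarrow> x - y \<in> S"
  obtains m M where "0 < m" and "0 \<le> M"
    and "\<And>x y. x \<in> S \<Longrightarrow> y \<in> S \<Longrightarrow> norm (x - y) \<le> m * norm (f x - f y)"
    and "\<And>x y. x \<in> S \<Longrightarrow> y \<in> S \<Longrightarrow> norm (f x - f y) \<le> M * norm (x - y)"
proof -
  obtain m M where m: "0 < m" "\<And>x. x \<in> S \<Longrightarrow> m * norm x \<le> norm (f x)"
    and M: "\<And>x. x \<in> S \<Longrightarrow> norm (f x) \<le> M * norm x"
    using f unfolding linear_embedding_def by blast
  have "norm (x - y) \<le> (1 / m) * norm (f x - f y)" if "x \<in> S" "y \<in> S" for x y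
    using m(2)[OF diff[OF that]] linear_embedding_diff[OF f diff that] m(1)
    by (simp add: field_simps)
  moreover have "norm (f x - f y) \<le> \<bar>M\<bar> * norm (x - y)" if "x \<in> S" "y \<in> S" for x y
    using M[OF diff[OF that]] linear_embedding_diff[OF f diff that]
      mult_right_mono[of M "\<bar>M\<bar>" "norm (x - y)"] by (auto intro: order_trans)
  ultimately show thesis
    using that[of "1 / m" "\<bar>M\<bar>"] m(1) by simp
qed

lemma linear_embedding_continuous_on:
  assumes f: "linear_embedding s1 S s2 f" and diff: "\<And>x y. x \<in> S \<Longrightarrow> y \<in> S \<Longrightarrow> x - y \<in> S"
  shows "continuous_on S f"
proof -
  obtain M where M: "0 \<le> M" "\<And>x y. x \<in> S \<Longrightarrow> y \<in> S \<Longrightarrow> norm (f x - f y) \<le> M * norm (x - y)"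
    using linear_embedding_bounds[OF f diff] by metis
  have "M-lipschitz_on S f"
    using M by (auto simp: lipschitz_on_def dist_norm)
  then show ?thesis
    by (rule lipschitz_on_continuous_on)
qed

lemma linear_embedding_lin_isomorphic:
  assumes f: "linear_embedding s1 S s2 f" and diff: "\<And>x y. x \<in> S \<Longrightarrow> y \<in> S \<Longrightarrow> x - y \<in> S"
  shows "lin_isomorphic s1 S s2 (f ` S)"
proof -
  obtain m where m: "0 < m" "\<And>x y. x \<in> S \<Longrightarrow> y \<in> S \<Longrightarrow> norm (x - y) \<le> m * norm (f x - f y)"
    using linear_embedding_bounds[OF f diff] by metis
  have inj: "inj_on f S"
  proof (rule inj_onI)
    fix x y
    assume "x \<in> S" "y \<in> S" "f x = f y"
    then show "x = y"
      using m(2)[of x y] by simp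
  qed
  have "m-lipschitz_on (f ` S) (inv_into S f)"
    unfolding lipschitz_on_def using m inj by (auto simp: dist_norm)
  then have "continuous_on (f ` S) (inv_into S f)"
    by (rule lipschitz_on_continuous_on)
  then have "homeomorphism S (f ` S) f (inv_into S f)"
    using linear_embedding_continuous_on[OF f diff] inj by (auto simp: homeomorphism_def image_iff)
  then show ?thesis
    using f unfolding lin_isomorphic_def linear_embedding_def by blast
qed

text \<open>
  The image of a Cauchy sequence under the inverse of an embedding is Cauchy again, so embeddings
  of complete sets commute with closure.
\<close>

lemma linear_embedding_image_closure:
  assumes f: "linear_embedding s1 (closure U) s2 f"
    and diff: "\<And>x y. x \<in> closure U \<Longrightarrow> y \<in> closure U \<Longrightarrow> x - y \<in> closure U"
  shows "f ` closure U = closure (f ` U)"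
proof
  have cont: "continuous_on (closure U) f"
    by (rule linear_embedding_continuous_on[OF f diff])
  then show "f ` closure U \<subseteq> closure (f ` U)"
    by (intro image_closure_subset) (auto simp: closure_subset)
  obtain m where m: "0 < m"
    "\<And>x y. x \<in> closure U \<Longrightarrow> y \<in> closure U \<Longrightarrow> norm (x - y) \<le> m * norm (f x - f y)"
    using linear_embedding_bounds[OF f diff] by metis
  show "closure (f ` U) \<subseteq> f ` closure U"
  proof
    fix y
    assume "y \<in> closure (f ` U)"
    then obtain v where v: "\<And>n. v n \<in> f ` U" "v \<longlonglongrightarrow> y"
      unfolding closure_sequential by blast
    then have "\<forall>n. \<exists>w. w \<in> U \<and> v n = f w"
      by blast
    then obtain u where u: "\<And>n. u n \<in> U" and vu: "\<And>n. v n = f (u n)"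
      by (metis (no_types))
    have lim: "(\<lambda>n. f (u n)) \<longlonglongrightarrow> y"
      using v(2) by (simp add: vu[symmetric])
    have "Cauchy u"
    proof (rule CauchyI)
      fix \<epsilon> :: real
      assume "0 < \<epsilon>"
      then obtain N where N: "\<And>i j. i \<ge> N \<Longrightarrow> j \<ge> N \<Longrightarrow> norm (f (u i) - f (u j)) < \<epsilon> / m"
        using LIMSEQ_imp_Cauchy[OF lim] m(1) by (meson CauchyD divide_pos_pos)
      have "norm (u i - u j) < \<epsilon>" if "i \<ge> N" "j \<ge> N" for i j
      proof -
        have "norm (u i - u j) \<le> m * norm (f (u i) - f (u j))"
          using u closure_subset by (intro m(2)) auto
        also have "\<dots> < m * (\<epsilon> / m)"
          using N[OF that] m(1) by (rule mult_strict_left_mono)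
        finally show ?thesis
          using m(1) by simp
      qed
      then show "\<exists>M. \<forall>i\<ge>M. \<forall>j\<ge>M. norm (u i - u j) < \<epsilon>"
        by blast
    qed
    then obtain x where x: "u \<longlonglongrightarrow> x"
      by (auto simp: Cauchy_convergent_iff convergent_def)
    then have xU: "x \<in> closure U"
      using u unfolding closure_sequential by blast
    have "(\<lambda>n. f (u n)) \<longlonglongrightarrow> f x"
      using u closure_subset by (intro continuous_on_tendsto_compose[OF cont x xU]) (auto intro!: always_eventually)
    then have "y = f x"
      using lim LIMSEQ_unique by blast
    then show "y \<in> f ` closure U"
      using xU by blast
  qed
qed

lemma lin_isomorphic_trans:
  assumes "lin_isomorphic s1 S s2 T" and "lin_isomorphic s2 T s3 U"
  shows "lin_isomorphic s1 S s3 U"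
proof -
  obtain f f' where f: "homeomorphism S T f f'"
    and f_add: "\<And>x y. x \<in> S \<Longrightarrow> y \<in> S \<Longrightarrow> f (x + y) = f x + f y"
    and f_sc: "\<And>c x. x \<in> S \<Longrightarrow> f (s1 c x) = s2 c (f x)"
    using assms(1) unfolding lin_isomorphic_def by blast
  obtain g g' where g: "homeomorphism T U g g'"
    and g_add: "\<And>x y. x \<in> T \<Longrightarrow> y \<in> T \<Longrightarrow> g (x + y) = g x + g y"
    and g_sc: "\<And>c x. x \<in> T \<Longrightarrow> g (s2 c x) = s3 c (g x)"
    using assms(2) unfolding lin_isomorphic_def by blast
  have fT: "x \<in> S \<Longrightarrow> f x \<in> T" for x
    using homeomorphism_image1[OF f] by blast
  have "homeomorphism S U (g \<circ> f) (f' \<circ> g')"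
    by (rule homeomorphism_compose[OF f g])
  then show ?thesis
    unfolding lin_isomorphic_def using fT f_add f_sc g_add g_sc
    by (intro exI[of _ "g \<circ> f"] exI[of _ "f' \<circ> g'"]) simp
qed

lemma lin_isomorphic_sym:
  assumes "lin_isomorphic s1 S s2 T"
    and add: "\<And>x y. x \<in> S \<Longrightarrow> y \<in> S \<Longrightarrow> x + y \<in> S" and sc: "\<And>c x. x \<in> S \<Longrightarrow> s1 c x \<in> S"
  shows "lin_isomorphic s2 T s1 S"
proof -
  obtain f g where h: "homeomorphism S T f g"
    and f_add: "\<And>x y. x \<in> S \<Longrightarrow> y \<in> S \<Longrightarrow> f (x + y) = f x + f y"
    and f_sc: "\<And>c x. x \<in> S \<Longrightarrow> f (s1 c x) = s2 c (f x)"
    using assms(1) unfolding lin_isomorphic_def by blast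
  have g: "g y \<in> S" "f (g y) = y" if "y \<in> T" for y
    using h that by (auto simp: homeomorphism_def)
  have gf: "g (f x) = x" if "x \<in> S" for x
    using h that by (auto simp: homeomorphism_def)
  have "g (x + y) = g x + g y" if "x \<in> T" "y \<in> T" for x y
    using gf[OF add[OF g(1) g(1)], OF that] f_add[OF g(1) g(1), OF that] g(2) that by simp
  moreover have "g (s2 c x) = s1 c (g x)" if "x \<in> T" for c x
    using gf[OF sc[OF g(1)], OF that] f_sc[OF g(1), OF that] g(2) that by simp
  ultimately show ?thesis
    unfolding lin_isomorphic_def using homeomorphism_symD[OF h] by blast
qed

lemma module_prod_scale:
  assumes "module s1" and "module s2"
  shows "module_prod.scale s1 s2 c (x, y) = (s1 c x, s2 c y)"
proof -
  interpret module_prod s1 s2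
    using assms by (simp add: module_prod_def module_pair_def)
  show ?thesis
    by (rule scale_prod)
qed

lemma module_banach_over: "banach_over sc \<Longrightarrow> module sc"
  by (simp add: banach_over_def module_iff_vector_space)

lemma banach_over_prod:
  assumes "banach_over s1" and "banach_over s2"
  shows "module (module_prod.scale s1 s2)"
proof -
  interpret module_prod s1 s2
    using assms by (simp add: module_prod_def module_pair_def module_banach_over)
  show ?thesis
    by (rule p.module_axioms)
qed

lemma lin_isomorphic_Times:
  fixes s1 :: "'k::real_or_complex \<Rightarrow> 'a::banach \<Rightarrow> 'a" and s2 :: "'k \<Rightarrow> 'b::banach \<Rightarrow> 'b"
    and s3 :: "'k \<Rightarrow> 'c::banach \<Rightarrow> 'c" and s4 :: "'k \<Rightarrow> 'd::banach \<Rightarrow> 'd"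
  assumes mods: "module s1" "module s2" "module s3" "module s4"
    and "lin_isomorphic s1 S s2 S'" and "lin_isomorphic s3 T s4 T'"
  shows "lin_isomorphic (module_prod.scale s1 s3) (S \<times> T) (module_prod.scale s2 s4) (S' \<times> T')"
proof -
  obtain f f' where f: "homeomorphism S S' f f'"
    and f_lin: "\<And>x y. x \<in> S \<Longrightarrow> y \<in> S \<Longrightarrow> f (x + y) = f x + f y" "\<And>c x. x \<in> S \<Longrightarrow> f (s1 c x) = s2 c (f x)"
    using assms(5) unfolding lin_isomorphic_def by blast
  obtain g g' where g: "homeomorphism T T' g g'"
    and g_lin: "\<And>x y. x \<in> T \<Longrightarrow> y \<in> T \<Longrightarrow> g (x + y) = g x + g y" "\<And>c x. x \<in> T \<Longrightarrow> g (s3 c x) = s4 c (g x)"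
    using assms(6) unfolding lin_isomorphic_def by blast
  let ?h = "\<lambda>p. (f (fst p), g (snd p))" and ?h' = "\<lambda>p. (f' (fst p), g' (snd p))"
  have "homeomorphism (S \<times> T) (S' \<times> T') ?h ?h'"
  proof (rule homeomorphismI)
    show "continuous_on (S \<times> T) ?h"
      by (intro continuous_on_Pair continuous_on_compose2[OF homeomorphism_cont1[OF f]]
          continuous_on_compose2[OF homeomorphism_cont1[OF g]] continuous_intros) auto
    show "continuous_on (S' \<times> T') ?h'"
      by (intro continuous_on_Pair continuous_on_compose2[OF homeomorphism_cont2[OF f]]
          continuous_on_compose2[OF homeomorphism_cont2[OF g]] continuous_intros) auto
  qed (use f g in \<open>auto simp: homeomorphism_def\<close>)
  then show ?thesis
    unfolding lin_isomorphic_def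
    by (intro exI[of _ ?h] exI[of _ ?h']) (auto simp: module_prod_scale mods f_lin g_lin)
qed

lemma lin_isomorphic_Times_assoc:
  fixes s1 :: "'k::real_or_complex \<Rightarrow> 'a::banach \<Rightarrow> 'a" and s2 :: "'k \<Rightarrow> 'b::banach \<Rightarrow> 'b"
    and s3 :: "'k \<Rightarrow> 'c::banach \<Rightarrow> 'c"
  assumes "banach_over s1" "banach_over s2" "banach_over s3"
  shows "lin_isomorphic (module_prod.scale (module_prod.scale s1 s2) s3) ((S \<times> T) \<times> U)
    (module_prod.scale s1 (module_prod.scale s2 s3)) (S \<times> (T \<times> U))"
proof -
  let ?h = "\<lambda>p. (fst (fst p), (snd (fst p), snd p))" and ?h' = "\<lambda>p. ((fst p, fst (snd p)), snd (snd p))"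
  have "homeomorphism ((S \<times> T) \<times> U) (S \<times> (T \<times> U)) ?h ?h'"
  proof (rule homeomorphismI)
    show "continuous_on ((S \<times> T) \<times> U) ?h"
      by (intro continuous_intros)
    show "continuous_on (S \<times> (T \<times> U)) ?h'"
      by (intro continuous_intros)
  qed auto
  then show ?thesis
    unfolding lin_isomorphic_def using assms
    by (intro exI[of _ ?h] exI[of _ ?h'])
      (auto simp: module_prod_scale module_banach_over banach_over_prod)
qed

lemma lin_isomorphic_refl: "lin_isomorphic sc S sc S"
  unfolding lin_isomorphic_def using homeomorphism_ident[of S]
  by (intro exI[of _ "\<lambda>a. a"]) auto

lemma lin_isomorphic_swap:
  fixes s1 :: "'k::real_or_complex \<Rightarrow> 'a::banach \<Rightarrow> 'a" and s2 :: "'k \<Rightarrow> 'b::banach \<Rightarrow> 'b"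
  assumes "banach_over s1" "banach_over s2"
  shows "lin_isomorphic (module_prod.scale s1 s2) (S \<times> T) (module_prod.scale s2 s1) (T \<times> S)"
proof -
  have "homeomorphism (S \<times> T) (T \<times> S) prod.swap prod.swap"
    by (rule homeomorphismI) (auto intro: continuous_on_swap)
  then show ?thesis
    unfolding lin_isomorphic_def using assms
    by (intro exI[of _ prod.swap]) (auto simp: module_prod_scale module_banach_over)
qed


section \<open>Closed spans\<close>

context banach_over
begin

sublocale sc: bounded_bilinear sc
proof
  fix r :: real and c :: 'k and x y :: 'a and d :: 'k
  show "sc (c + d) x = sc c x + sc d x" "sc c (x + y) = sc c x + sc c y"
    by (rule scale_left_distrib scale_right_distrib)+
  have "sc (r *\<^sub>R c) x = sc (r *\<^sub>R 1) (sc c x)"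
    by simp
  then show "sc (r *\<^sub>R c) x = r *\<^sub>R sc c x"
    by (simp only: scale_real)
  have "sc c (r *\<^sub>R x) = sc c (sc (r *\<^sub>R 1) x)"
    by (simp only: scale_real)
  also have "\<dots> = sc (r *\<^sub>R 1) (sc c x)"
    by (rule scale_left_commute)
  finally show "sc c (r *\<^sub>R x) = r *\<^sub>R sc c x"
    by (simp only: scale_real)
next
  show "\<exists>K. \<forall>c x. norm (sc c x) \<le> norm c * norm x * K"
    by (rule exI[of _ 1]) (simp add: norm_scale)
qed

definition cspan :: "'a set \<Rightarrow> 'a set" where
  "cspan S = closure (span S)"

lemma closed_span_eq: "closed_span sc y = cspan (range y)"
  by (simp add: closed_span_def cspan_def)

lemma span_subset_cspan: "span S \<subseteq> cspan S"
  by (simp add: cspan_def closure_subset)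

lemma cspan_subset: "S \<subseteq> span T \<Longrightarrow> cspan S \<subseteq> cspan T"
  unfolding cspan_def by (intro closure_mono span_minimal subspace_span)

lemma cspan_approx:
  assumes "x \<in> cspan S"
  obtains u where "\<And>n. u n \<in> span S" and "u \<longlonglongrightarrow> x"
  using assms unfolding cspan_def closure_sequential by blast

lemma cspan_limit: "(\<And>n. u n \<in> span S) \<Longrightarrow> u \<longlonglongrightarrow> x \<Longrightarrow> x \<in> cspan S"
  unfolding cspan_def closure_sequential by blast

lemma cspan_add:
  assumes "x \<in> cspan S" "y \<in> cspan S"
  shows "x + y \<in> cspan S"
proof -
  obtain u v where "\<And>n. u n \<in> span S" "u \<longlonglongrightarrow> x" "\<And>n. v n \<in> span S" "v \<longlonglongrightarrow> y"
    using assms by (metis cspan_approx)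
  then show ?thesis
    by (intro cspan_limit[of "\<lambda>n. u n + v n"] span_add tendsto_add)
qed

lemma cspan_scale:
  assumes "x \<in> cspan S"
  shows "sc c x \<in> cspan S"
proof -
  obtain u where "\<And>n. u n \<in> span S" "u \<longlonglongrightarrow> x"
    using assms by (metis cspan_approx)
  then show ?thesis
    by (intro cspan_limit[of "\<lambda>n. sc c (u n)"] span_scale sc.tendsto tendsto_const)
qed

lemma cspan_diff: "x \<in> cspan S \<Longrightarrow> y \<in> cspan S \<Longrightarrow> x - y \<in> cspan S"
  using cspan_add[of x S "sc (- 1) y"] cspan_scale[of y S "- 1"] by simp

lemma cspan_superset: "S \<subseteq> cspan S"
  using span_superset span_subset_cspan by blast

lemma cspan_zero: "0 \<in> cspan S"
  using span_zero span_subset_cspan by blast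

lemma lin_isomorphic_cspan_sym:
  "lin_isomorphic sc (cspan S) s2 T \<Longrightarrow> lin_isomorphic s2 T sc (cspan S)"
  by (rule lin_isomorphic_sym) (auto intro: cspan_add cspan_scale)

lemma linear_embedding_span_image:
  assumes "linear_embedding sc (cspan S) sc f" and "T \<subseteq> cspan S"
  shows "f ` span T = span (f ` T)"
proof -
  have spanT: "span T \<subseteq> cspan S"
    using assms(2) span_minimal[of T "cspan S"]
    by (simp add: subspace_def cspan_add cspan_scale cspan_zero)
  have add: "f (x + y) = f x + f y" and sc: "f (sc c x) = sc c (f x)"
    if "x \<in> span T" "y \<in> span T" for c x y
    using assms(1) spanT that unfolding linear_embedding_def by blast+
  have f0: "f 0 = 0"
    using sc[of 0 0 0] span_zero by simp
  show ?thesis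
  proof
    have "x \<in> span T \<and> f x \<in> span (f ` T)" if "x \<in> span T" for x
      using that
    proof (induction rule: span_induct_alt)
      case base
      then show ?case
        by (simp add: f0 span_zero)
    next
      case (step c x y)
      have x: "x \<in> span T"
        using step by (simp add: span_base)
      have "f (sc c x + y) = sc c (f x) + f y"
        using add[of "sc c x" y] sc[OF x x] step x by (simp add: span_scale)
      then show ?case
        using step x by (auto intro!: span_add span_scale intro: span_base)
    qed
    then show "f ` span T \<subseteq> span (f ` T)"
      by blast
    show "span (f ` T) \<subseteq> f ` span T"
    proof
      fix z
      assume "z \<in> span (f ` T)"
      then show "z \<in> f ` span T"
      proof (induction rule: span_induct_alt)
        case base
        then show ?case
          using f0 span_zero by (metis image_eqI)
      next
        case (step c x y)
        then obtain x' y' where xy: "x' \<in> T" "x = f x'" "y' \<in> span T" "y = f y'"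
          by blast
        then have "sc c x + y = f (sc c x' + y')"
          using add[of "sc c x'" y'] sc[of x' x' c] by (simp add: span_base span_scale)
        then show ?case
          using xy by (auto intro!: imageI span_add span_scale intro: span_base)
      qed
    qed
  qed
qed

lemma linear_embedding_cspan_image:
  assumes f: "linear_embedding sc (cspan S) sc f"
  shows "f ` cspan S = cspan (f ` S)"
proof -
  have "f ` cspan S = closure (f ` span S)"
    unfolding cspan_def
    by (rule linear_embedding_image_closure) (use f cspan_diff in \<open>auto simp: cspan_def\<close>)
  also have "\<dots> = cspan (f ` S)"
    by (simp add: cspan_def linear_embedding_span_image[OF f cspan_superset])
  finally show ?thesis .
qed

lemma linear_embedding_cspan_lin_isomorphic:
  assumes "linear_embedding sc (cspan S) sc f"
  shows "lin_isomorphic sc (cspan S) sc (cspan (f ` S))"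
  using linear_embedding_lin_isomorphic[OF assms cspan_diff] linear_embedding_cspan_image[OF assms]
  by simp

text \<open>
  The estimate says that addition is bounded below on \<open>span S \<times> span T\<close>. It survives the passage to
  closures, which turns the algebraic sum into a topological direct sum.
\<close>

lemma cspan_Un_lin_isomorphic:
  assumes K: "\<And>u v. u \<in> span S \<Longrightarrow> v \<in> span T \<Longrightarrow> norm u \<le> K * norm (u + v) \<and> norm v \<le> K * norm (u + v)"
  shows "lin_isomorphic (module_prod.scale sc sc) (cspan S \<times> cspan T) sc (cspan (S \<union> T))"
proof -
  let ?f = "\<lambda>p::'a \<times> 'a. fst p + snd p"
  have cl: "cspan S \<times> cspan T = closure (span S \<times> span T)"
    by (simp add: cspan_def closure_Times)
  have diff: "p - q \<in> cspan S \<times> cspan T" if "p \<in> cspan S \<times> cspan T" "q \<in> cspan S \<times> cspan T" for p q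
    using that by (auto intro: cspan_diff)
  have K': "norm u \<le> K * norm (u + v) \<and> norm v \<le> K * norm (u + v)" if u: "u \<in> cspan S" and v: "v \<in> cspan T" for u v
  proof -
    obtain a b where ab: "\<And>n. a n \<in> span S" "a \<longlonglongrightarrow> u" "\<And>n. b n \<in> span T" "b \<longlonglongrightarrow> v"
      using cspan_approx[OF u] cspan_approx[OF v] by metis
    have "norm u \<le> K * norm (u + v)"
      by (rule LIMSEQ_le[OF tendsto_norm[OF ab(2)]
            tendsto_mult_left[OF tendsto_norm[OF tendsto_add[OF ab(2,4)]]]]) (use K ab in auto)
    moreover have "norm v \<le> K * norm (u + v)"
      by (rule LIMSEQ_le[OF tendsto_norm[OF ab(4)]
            tendsto_mult_left[OF tendsto_norm[OF tendsto_add[OF ab(2,4)]]]]) (use K ab in auto)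
    ultimately show ?thesis ..
  qed
  have low: "1 / (2 * \<bar>K\<bar> + 1) * norm p \<le> norm (?f p)" if "p \<in> cspan S \<times> cspan T" for p
  proof -
    have "norm p \<le> norm (fst p) + norm (snd p)"
      by (metis norm_Pair_le prod.collapse)
    also have "\<dots> \<le> 2 * (K * norm (?f p))"
      using K'[of "fst p" "snd p"] that by auto
    also have "\<dots> \<le> (2 * \<bar>K\<bar> + 1) * norm (?f p)"
      using mult_right_mono[of "2 * K" "2 * \<bar>K\<bar> + 1" "norm (?f p)"] by (simp add: mult.assoc)
    finally show ?thesis
      by (simp add: field_simps)
  qed
  have "norm (?f p) \<le> 2 * norm p" for p :: "'a \<times> 'a"
    using norm_triangle_ineq[of "fst p" "snd p"] norm_fst_le[of "fst p" "snd p"]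
      norm_snd_le[of "snd p" "fst p"] by simp
  then have "\<exists>M. \<forall>p\<in>cspan S \<times> cspan T. norm (?f p) \<le> M * norm p"
    by blast
  moreover have "\<exists>m>0. \<forall>p\<in>cspan S \<times> cspan T. m * norm p \<le> norm (?f p)"
    using low by (intro exI[of _ "1 / (2 * \<bar>K\<bar> + 1)"]) (auto simp: add_nonneg_pos)
  ultimately have emb: "linear_embedding (module_prod.scale sc sc) (cspan S \<times> cspan T) sc ?f"
    unfolding linear_embedding_def
    by (auto simp: module_prod_scale[OF module_axioms module_axioms] scale_right_distrib)
  have "?f ` (cspan S \<times> cspan T) = closure (?f ` (span S \<times> span T))"
    unfolding cl by (rule linear_embedding_image_closure) (use emb diff in \<open>auto simp: cl[symmetric]\<close>)
  also have "?f ` (span S \<times> span T) = span (S \<union> T)"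
    unfolding span_Un by force
  finally show ?thesis
    using linear_embedding_lin_isomorphic[OF emb diff] by (simp add: cspan_def)
qed


section \<open>Unconditional sequences and their coordinates\<close>

text \<open>
  Stating the suppression estimate for spans over disjoint index sets, rather than for coefficient
  sums, makes it pass to block-sequences without computation: spans of disjoint sets of blocks lie
  in spans of disjoint sets of basis vectors.
\<close>

definition uncond :: "(nat \<Rightarrow> 'a) \<Rightarrow> real \<Rightarrow> bool" where
  "uncond e K \<longleftrightarrow>
     (\<forall>i. e i \<noteq> 0) \<and>
     (\<forall>I J u v. I \<inter> J = {} \<longrightarrow> u \<in> span (e ` I) \<longrightarrow> v \<in> span (e ` J) \<longrightarrow> norm u \<le> K * norm (u + v))"

lemma uncond_nonzero: "uncond e K \<Longrightarrow> e i \<noteq> 0"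
  by (simp add: uncond_def)

lemma uncond_norm_le:
  "uncond e K \<Longrightarrow> I \<inter> J = {} \<Longrightarrow> u \<in> span (e ` I) \<Longrightarrow> v \<in> span (e ` J) \<Longrightarrow> norm u \<le> K * norm (u + v)"
  unfolding uncond_def by blast

lemma uncond_ge_1:
  assumes "uncond e K"
  shows "1 \<le> K"
proof -
  have "norm (e 0) \<le> K * norm (e 0 + 0)"
    by (rule uncond_norm_le[OF assms, of "{0}" "{}"]) (auto intro: span_base)
  then show ?thesis
    using uncond_nonzero[OF assms, of 0] by simp
qed

lemma sum_in_span: "A \<subseteq> I \<Longrightarrow> (\<Sum>i\<in>A. sc (a i) (e i)) \<in> span (e ` I)"
  by (intro span_sum span_scale span_base) auto

lemma span_image_sum:
  assumes "u \<in> span (e ` I)"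
  obtains A a where "finite A" "A \<subseteq> I" "u = (\<Sum>i\<in>A. sc (a i) (e i))" "{i. a i \<noteq> 0} \<subseteq> A"
proof -
  have "\<exists>A a. finite A \<and> A \<subseteq> I \<and> u = (\<Sum>i\<in>A. sc (a i) (e i)) \<and> (\<forall>i. i \<notin> A \<longrightarrow> a i = 0)"
    using assms
  proof (induction rule: span_induct_alt)
    case base
    then show ?case
      by (intro exI[of _ "{}"] exI[of _ "\<lambda>_. 0"]) auto
  next
    case (step c x y)
    then obtain i A a where i: "i \<in> I" "x = e i" and A: "finite A" "A \<subseteq> I"
      "y = (\<Sum>i\<in>A. sc (a i) (e i))" "\<And>i. i \<notin> A \<Longrightarrow> a i = 0"
      by blast
    let ?b = "\<lambda>k. (if k = i then c else 0) + a k"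
    have "y = (\<Sum>k\<in>insert i A. sc (a k) (e k))"
      unfolding A(3) using A by (intro sum.mono_neutral_left) auto
    moreover have "sc c (e i) = (\<Sum>k\<in>insert i A. sc (if k = i then c else 0) (e k))"
      using A(1) by (simp add: if_distrib[where f="\<lambda>t. sc t _"] sum.delta cong: if_cong)
    ultimately have "sc c x + y = (\<Sum>k\<in>insert i A. sc (?b k) (e k))"
      by (simp only: i(2) sum.distrib scale_left_distrib)
    moreover have "?b k = 0" if "k \<notin> insert i A" for k
      using that A(4) by auto
    ultimately have "finite (insert i A) \<and> insert i A \<subseteq> I \<and> sc c x + y = (\<Sum>k\<in>insert i A. sc (?b k) (e k)) \<and>
        (\<forall>k. k \<notin> insert i A \<longrightarrow> ?b k = 0)"
      using A(1,2) i(1) by blast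
    then show ?case
      by (rule exI[of _ ?b, THEN exI[of _ "insert i A"]])
  qed
  then obtain A a where A: "finite A" "A \<subseteq> I" "u = (\<Sum>i\<in>A. sc (a i) (e i))" "\<forall>i. i \<notin> A \<longrightarrow> a i = 0"
    by (elim exE conjE)
  show thesis
    by (rule that[OF A(1-3)]) (use A(4) in blast)
qed

lemma expansion_of_span:
  assumes "u \<in> span (e ` I)"
  obtains a where "(\<lambda>i. sc (a i) (e i)) sums u" "finite {i. a i \<noteq> 0}" "{i. a i \<noteq> 0} \<subseteq> I"
proof -
  obtain A a where A: "finite A" "A \<subseteq> I" "u = (\<Sum>i\<in>A. sc (a i) (e i))" "{i. a i \<noteq> 0} \<subseteq> A"
    by (rule span_image_sum[OF assms])
  have "(\<lambda>i. sc (a i) (e i)) sums u"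
    unfolding A(3) using A by (intro sums_finite) auto
  then show thesis
    using that[of a] A(2,4) finite_subset[OF A(4,1)] by blast
qed

text \<open>
  Expansions pass to limits when all their finite partial sums converge uniformly: each coefficient
  sequence is then Cauchy, and partial sums and limits may be interchanged.
\<close>

lemma limit_of_expansions:
  fixes a :: "nat \<Rightarrow> nat \<Rightarrow> 'k"
  assumes nz: "\<And>i. e i \<noteq> 0" and sums: "\<And>n. (\<lambda>i. sc (a n i) (e i)) sums x n" and lim: "x \<longlonglongrightarrow> X"
    and unif: "\<And>\<epsilon>. 0 < \<epsilon> \<Longrightarrow>
      \<exists>N. \<forall>m\<ge>N. \<forall>n\<ge>N. \<forall>A. finite A \<longrightarrow> norm (\<Sum>i\<in>A. sc (a m i - a n i) (e i)) \<le> \<epsilon>"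
  shows "\<exists>b. (\<lambda>i. sc (b i) (e i)) sums X \<and> (\<forall>i. (\<lambda>n. a n i) \<longlonglongrightarrow> b i)"
proof -
  have "Cauchy (\<lambda>n. a n i)" for i
  proof (rule CauchyI)
    fix \<epsilon> :: real
    assume "0 < \<epsilon>"
    then have pos: "0 < \<epsilon> * norm (e i) / 2"
      using nz[of i] by simp
    obtain N where N: "\<And>m n A. m \<ge> N \<Longrightarrow> n \<ge> N \<Longrightarrow> finite A \<Longrightarrow>
        norm (\<Sum>i\<in>A. sc (a m i - a n i) (e i)) \<le> \<epsilon> * norm (e i) / 2"
      using unif[OF pos] by blast
    have "norm (a m i - a n i) < \<epsilon>" if "m \<ge> N" "n \<ge> N" for m n
    proof -
      have "norm (a m i - a n i) * norm (e i) \<le> (\<epsilon> / 2) * norm (e i)"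
        using N[OF that, of "{i}"] by (simp add: norm_scale)
      then have "norm (a m i - a n i) \<le> \<epsilon> / 2"
        using nz[of i] by (simp add: mult_le_cancel_right)
      then show ?thesis
        using \<open>0 < \<epsilon>\<close> by linarith
    qed
    then show "\<exists>N. \<forall>m\<ge>N. \<forall>n\<ge>N. norm (a m i - a n i) < \<epsilon>"
      by blast
  qed
  then have "\<forall>i. \<exists>l. (\<lambda>n. a n i) \<longlonglongrightarrow> l"
    using scalar_Cauchy_convergent unfolding convergent_def by blast
  then obtain b where b: "\<And>i. (\<lambda>n. a n i) \<longlonglongrightarrow> b i"
    by metis
  have "(\<lambda>i. sc (b i) (e i)) sums X"
    unfolding sums_def
  proof (rule LIMSEQ_I)
    fix \<epsilon> :: real
    assume "0 < \<epsilon>"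
    then have pos: "0 < \<epsilon> / 4"
      by simp
    obtain N where N: "\<And>m n A. m \<ge> N \<Longrightarrow> n \<ge> N \<Longrightarrow> finite A \<Longrightarrow>
        norm (\<Sum>i\<in>A. sc (a m i - a n i) (e i)) \<le> \<epsilon> / 4"
      using unif[OF pos] by blast
    obtain N' where N': "\<And>n. n \<ge> N' \<Longrightarrow> norm (x n - X) < \<epsilon> / 4"
      using LIMSEQ_D[OF lim pos] by blast
    let ?n = "max N N'"
    have tail: "norm (\<Sum>i\<in>A. sc (b i - a ?n i) (e i)) \<le> \<epsilon> / 4" if "finite A" for A
    proof (rule Lim_bounded)
      show "(\<lambda>m. norm (\<Sum>i\<in>A. sc (a m i - a ?n i) (e i))) \<longlonglongrightarrow> norm (\<Sum>i\<in>A. sc (b i - a ?n i) (e i))"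
        by (intro tendsto_norm tendsto_sum sc.tendsto tendsto_diff b tendsto_const)
      show "\<forall>m\<ge>N. norm (\<Sum>i\<in>A. sc (a m i - a ?n i) (e i)) \<le> \<epsilon> / 4"
        using N that by simp
    qed
    obtain L where L: "\<And>k. k \<ge> L \<Longrightarrow> norm ((\<Sum>i<k. sc (a ?n i) (e i)) - x ?n) < \<epsilon> / 4"
      using LIMSEQ_D[OF sums[of ?n, unfolded sums_def] pos] by blast
    have "norm ((\<Sum>i<k. sc (b i) (e i)) - X) < \<epsilon>" if "k \<ge> L" for k
    proof -
      let ?p = "\<Sum>i<k. sc (b i - a ?n i) (e i)" and ?q = "(\<Sum>i<k. sc (a ?n i) (e i)) - x ?n"
      have "(\<Sum>i<k. sc (b i) (e i)) - X = (?p + ?q) + (x ?n - X)"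
        by (simp add: scale_left_diff_distrib sum_subtractf)
      also have "norm \<dots> \<le> norm (?p + ?q) + norm (x ?n - X)"
        by (rule norm_triangle_ineq)
      also have "\<dots> \<le> norm ?p + norm ?q + norm (x ?n - X)"
        by (intro add_right_mono norm_triangle_ineq)
      also have "\<dots> < \<epsilon>"
        using tail[of "{..<k}"] L[OF that] N'[of ?n] \<open>0 < \<epsilon>\<close> by simp
      finally show ?thesis .
    qed
    then show "\<exists>L. \<forall>k\<ge>L. norm ((\<Sum>i<k. sc (b i) (e i)) - X) < \<epsilon>"
      by blast
  qed
  then show ?thesis
    using b by blast
qed

lemma uncond_sums_bound:
  assumes e: "uncond e K" and x: "(\<lambda>i. sc (a i) (e i)) sums x" and A: "finite A"
  shows "norm (\<Sum>i\<in>A. sc (a i) (e i)) \<le> K * norm x"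
proof -
  obtain N where N: "A \<subseteq> {..<N}"
    using A finite_nat_iff_bounded by blast
  have "(\<lambda>n. K * norm (\<Sum>i<n. sc (a i) (e i))) \<longlonglongrightarrow> K * norm x"
    using x unfolding sums_def by (intro tendsto_mult_left tendsto_norm)
  then show ?thesis
  proof (rule Lim_bounded2)
    show "\<forall>n\<ge>N. norm (\<Sum>i\<in>A. sc (a i) (e i)) \<le> K * norm (\<Sum>i<n. sc (a i) (e i))"
    proof (intro allI impI)
      fix n
      assume "n \<ge> N"
      then have split: "(\<Sum>i<n. sc (a i) (e i)) = (\<Sum>i\<in>A. sc (a i) (e i)) + (\<Sum>i\<in>{..<n} - A. sc (a i) (e i))"
        using N by (intro sum.subset_diff[THEN trans, OF _ _ add.commute]) auto
      show "norm (\<Sum>i\<in>A. sc (a i) (e i)) \<le> K * norm (\<Sum>i<n. sc (a i) (e i))"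
        unfolding split by (rule uncond_norm_le[OF e, of A "{..<n} - A"]) (auto intro: sum_in_span)
    qed
  qed
qed

lemma uncond_sums_unique:
  assumes e: "uncond e K" and "(\<lambda>i. sc (a i) (e i)) sums x" and "(\<lambda>i. sc (b i) (e i)) sums x"
  shows "a = b"
proof
  fix i
  have "(\<lambda>i. sc (a i - b i) (e i)) sums (x - x)"
    unfolding scale_left_diff_distrib by (rule sums_diff[OF assms(2,3)])
  then have "norm (\<Sum>i\<in>{i}. sc (a i - b i) (e i)) \<le> K * norm (x - x)"
    by (rule uncond_sums_bound[OF e]) simp
  then show "a i = b i"
    using uncond_nonzero[OF e, of i] by simp
qed

text \<open>
  By unconditionality, coordinates and partial sums of elements of the span are controlled by the
  norm, so the expansions of an approximating sequence converge uniformly.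
\<close>

lemma uncond_expansion:
  assumes e: "uncond e K" and x: "x \<in> cspan (range e)"
  obtains a where "(\<lambda>i. sc (a i) (e i)) sums x"
proof -
  obtain u where u: "\<And>n. u n \<in> span (range e)" and lim: "u \<longlonglongrightarrow> x"
    by (rule cspan_approx[OF x]) blast
  have "\<forall>n. \<exists>a. (\<lambda>i. sc (a i) (e i)) sums u n"
    using expansion_of_span[of _ e UNIV] u by metis
  then obtain a where a: "\<And>n. (\<lambda>i. sc (a n i) (e i)) sums u n"
    by metis
  have "\<exists>b. (\<lambda>i. sc (b i) (e i)) sums x \<and> (\<forall>i. (\<lambda>n. a n i) \<longlonglongrightarrow> b i)"
  proof (rule limit_of_expansions[OF uncond_nonzero[OF e] a lim])
    fix \<epsilon> :: real
    assume "0 < \<epsilon>"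
    have K: "0 < K"
      using uncond_ge_1[OF e] by simp
    obtain N where N: "\<And>m n. m \<ge> N \<Longrightarrow> n \<ge> N \<Longrightarrow> norm (u m - u n) < \<epsilon> / K"
      using LIMSEQ_imp_Cauchy[OF lim] \<open>0 < \<epsilon>\<close> K by (meson CauchyD divide_pos_pos)
    have "norm (\<Sum>i\<in>A. sc (a m i - a n i) (e i)) \<le> \<epsilon>" if "m \<ge> N" "n \<ge> N" "finite A" for m n A
    proof -
      have "(\<lambda>i. sc (a m i - a n i) (e i)) sums (u m - u n)"
        unfolding scale_left_diff_distrib by (intro sums_diff a)
      then have "norm (\<Sum>i\<in>A. sc (a m i - a n i) (e i)) \<le> K * norm (u m - u n)"
        using that(3) by (rule uncond_sums_bound[OF e])
      also have "\<dots> \<le> K * (\<epsilon> / K)"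
        using N[OF that(1,2)] K by (intro mult_left_mono) auto
      finally show ?thesis
        using K by simp
    qed
    then show "\<exists>N. \<forall>m\<ge>N. \<forall>n\<ge>N. \<forall>A. finite A \<longrightarrow> norm (\<Sum>i\<in>A. sc (a m i - a n i) (e i)) \<le> \<epsilon>"
      by blast
  qed
  then show thesis
    using that by blast
qed

lemma coords_eqI: "uncond e K \<Longrightarrow> (\<lambda>i. sc (a i) (e i)) sums x \<Longrightarrow> coords sc e x = a"
  unfolding coords_def by (rule the_equality) (auto dest: uncond_sums_unique)

lemma coords_sums:
  assumes "uncond e K" "x \<in> cspan (range e)"
  shows "(\<lambda>i. sc (coords sc e x i) (e i)) sums x"
proof -
  obtain a where "(\<lambda>i. sc (a i) (e i)) sums x"
    by (rule uncond_expansion[OF assms])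
  then show ?thesis
    by (simp add: coords_eqI[OF assms(1)])
qed

lemma coords_add:
  assumes "uncond e K" "x \<in> cspan (range e)" "y \<in> cspan (range e)"
  shows "coords sc e (x + y) i = coords sc e x i + coords sc e y i"
proof -
  have "(\<lambda>i. sc (coords sc e x i + coords sc e y i) (e i)) sums (x + y)"
    unfolding scale_left_distrib by (intro sums_add coords_sums[OF assms(1)] assms)
  then show ?thesis
    by (simp add: coords_eqI[OF assms(1)])
qed

lemma coords_scale:
  assumes "uncond e K" "x \<in> cspan (range e)"
  shows "coords sc e (sc c x) i = c * coords sc e x i"
proof -
  have "(\<lambda>i. sc c (sc (coords sc e x i) (e i))) sums sc c x"
    by (intro bounded_linear.sums[OF sc.bounded_linear_right] coords_sums[OF assms(1)] assms)
  then have "(\<lambda>i. sc (c * coords sc e x i) (e i)) sums sc c x"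
    by simp
  from coords_eqI[OF assms(1) this] show ?thesis
    by simp
qed

lemma coords_bound:
  assumes "uncond e K" "x \<in> cspan (range e)"
  shows "norm (coords sc e x i) * norm (e i) \<le> K * norm x"
  using uncond_sums_bound[OF assms(1) coords_sums[OF assms], of "{i}"] by (simp add: norm_scale)

lemma coords_basis:
  assumes "uncond e K"
  shows "coords sc e (e i) = (\<lambda>k. if k = i then 1 else 0)"
proof (rule coords_eqI[OF assms])
  have "(\<lambda>k. if k = i then e k else 0) sums e i"
    by (rule sums_single)
  then show "(\<lambda>k. sc (if k = i then 1 else 0) (e k)) sums e i"
    by (simp add: if_distrib[where f="\<lambda>t. sc t _"] cong: if_cong)
qed

lemma supp_span:
  assumes "uncond e K" "u \<in> span (e ` I)"
  shows "finite (supp sc e u)" and "supp sc e u \<subseteq> I"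
proof -
  obtain a where "(\<lambda>i. sc (a i) (e i)) sums u" "finite {i. a i \<noteq> 0}" "{i. a i \<noteq> 0} \<subseteq> I"
    by (rule expansion_of_span[OF assms(2)])
  then show "finite (supp sc e u)" "supp sc e u \<subseteq> I"
    by (simp_all add: supp_def coords_eqI[OF assms(1)])
qed

lemma sum_coords:
  assumes "uncond e K" "x \<in> cspan (range e)" "finite A" "supp sc e x \<subseteq> A"
  shows "x = (\<Sum>i\<in>A. sc (coords sc e x i) (e i))"
proof (rule sums_unique2[OF coords_sums[OF assms(1,2)]])
  show "(\<lambda>i. sc (coords sc e x i) (e i)) sums (\<Sum>i\<in>A. sc (coords sc e x i) (e i))"
    using assms(3,4) by (intro sums_finite) (auto simp: supp_def)
qed

lemma span_supp:
  assumes "uncond e K" "x \<in> cspan (range e)" "finite (supp sc e x)"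
  shows "x \<in> span (e ` supp sc e x)"
  by (rule ssubst[OF sum_coords[OF assms order_refl], of "\<lambda>z. z \<in> span (e ` supp sc e x)"])
    (rule sum_in_span[OF order_refl])

lemma supp_nonempty:
  assumes "uncond e K" "x \<in> span (range e)" "x \<noteq> 0"
  shows "supp sc e x \<noteq> {}"
  using sum_coords[OF assms(1), of x "{}"] assms(2,3) span_subset_cspan by auto

lemma finitely_supported_eq_span:
  assumes "uncond e K"
  shows "finitely_supported sc e = span (range e)"
proof
  show "finitely_supported sc e \<subseteq> span (range e)"
    unfolding finitely_supported_def closed_span_eq
    using span_supp[OF assms] span_mono[of "e ` _" "range e"] by blast
  show "span (range e) \<subseteq> finitely_supported sc e"
    unfolding finitely_supported_def closed_span_eq
    using supp_span(1)[OF assms] span_subset_cspan by blast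
qed


section \<open>Unconditional bases have a suppression constant\<close>

text \<open>
  Unconditional convergence bounds the partial sums of each vector, so by Baire's theorem one level
  set of these bounds is dense in a ball. Every vector is then a limit of a geometrically
  convergent series of vectors with controlled partial sums, as in the open mapping theorem, and
  \<open>limit_of_expansions\<close> carries the control over to the vector itself.
\<close>

lemma unconditional_basis_uncond:
  assumes e: "unconditional_basis sc e"
  obtains K where "uncond e K"
proof -
  define c where "c = coords sc e"
  have ex1: "\<exists>!a. (\<lambda>i. sc (a i) (e i)) sums x" for x
    using e by (simp add: unconditional_basis_def schauder_basis_def)
  have c_sums: "(\<lambda>i. sc (c x i) (e i)) sums x" for x
    unfolding c_def coords_def by (rule theI'[OF ex1])
  have c_eqI: "c x = a" if "(\<lambda>i. sc (a i) (e i)) sums x" for x a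
    using ex1[of x] c_sums that by blast
  have nz: "e i \<noteq> 0" for i
  proof
    assume "e i = 0"
    then have "c 0 = (\<lambda>k. if k = i then 1 else 0)" "c 0 = (\<lambda>_. 0)"
      by (auto intro!: c_eqI sums_finite[where N="{}", simplified])
    then show False
      by (metis zero_neq_one)
  qed
  have c_diff: "c (x - y) = (\<lambda>i. c x i - c y i)" for x y
    by (rule c_eqI, unfold scale_left_diff_distrib, intro sums_diff c_sums)
  have c_scaleR: "c (r *\<^sub>R x) = (\<lambda>i. r *\<^sub>R c x i)" for r x
    by (rule c_eqI, unfold sc.scaleR_left, intro sums_scaleR_right c_sums)
  define P where "P A x = (\<Sum>i\<in>A. sc (c x i) (e i))" for A x
  have P_diff: "P A (x - y) = P A x - P A y" for A x y
    by (simp add: P_def c_diff scale_left_diff_distrib sum_subtractf)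
  have P_scaleR: "P A (r *\<^sub>R x) = r *\<^sub>R P A x" for A r x
    by (simp add: P_def c_scaleR sc.scaleR_left scaleR_sum_right)
  define V where "V n = {x. \<forall>A. finite A \<longrightarrow> norm (P A x) \<le> real n}" for n
  have cover: "\<exists>n. x \<in> V n" for x
  proof -
    have "((\<lambda>i. sc (c x i) (e i)) has_sum x) UNIV"
      using e c_sums by (simp add: unconditional_basis_def)
    then have "((\<lambda>A. P A x) \<longlongrightarrow> x) (finite_subsets_at_top UNIV)"
      by (simp add: has_sum_def P_def)
    then have "\<forall>\<^sub>F A in finite_subsets_at_top UNIV. dist (P A x) x < 1"
      by (rule tendstoD) simp
    then obtain A0 where "finite A0"
      and near: "\<forall>A. finite A \<and> A0 \<subseteq> A \<and> A \<subseteq> UNIV \<longrightarrow> dist (P A x) x < 1"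
      unfolding eventually_finite_subsets_at_top by (elim exE conjE)
    then have A0: "finite A0" "\<And>A. finite A \<Longrightarrow> A0 \<subseteq> A \<Longrightarrow> dist (P A x) x < 1"
      by simp_all
    define m where "m = norm x + 1 + (\<Sum>i\<in>A0. norm (sc (c x i) (e i)))"
    have "norm (P A x) \<le> m" if "finite A" for A
    proof -
      have "P (A \<union> A0) x = P A x + P (A0 - A) x"
        unfolding P_def by (subst sum.union_disjoint[symmetric]) (use that A0(1) in auto)
      then have "norm (P A x) \<le> norm (P (A \<union> A0) x) + norm (P (A0 - A) x)"
        using norm_triangle_ineq4[of "P A x + P (A0 - A) x" "P (A0 - A) x"] by simp
      moreover have "norm (P (A \<union> A0) x) \<le> norm x + 1"
        using A0(2)[of "A \<union> A0"] A0(1) that norm_triangle_sub[of "P (A \<union> A0) x" x] by (simp add: dist_norm)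
      moreover have "norm (P (A0 - A) x) \<le> (\<Sum>i\<in>A0. norm (sc (c x i) (e i)))"
        unfolding P_def using A0(1) by (intro order_trans[OF norm_sum] sum_mono2) auto
      ultimately show ?thesis
        unfolding m_def by linarith
    qed
    moreover have "m \<le> real (nat \<lceil>m\<rceil>)"
      by linarith
    ultimately show ?thesis
      unfolding V_def using order_trans by blast
  qed
  have "\<exists>n. interior (closure (V n)) \<noteq> {}"
  proof (rule ccontr)
    assume "\<not> ?thesis"
    then have "euclidean interior_of \<Union>(range (\<lambda>n. closure (V n))) = {}"
      by (intro Baire_category_alt) (auto simp: completely_metrizable_space_euclidean)
    moreover have "\<Union>(range (\<lambda>n. closure (V n))) = UNIV"
    proof (rule UNIV_eq_I[symmetric])
      fix x
      obtain n where "x \<in> V n"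
        using cover by blast
      then have "x \<in> closure (V n)"
        using closure_subset by blast
      then show "x \<in> \<Union>(range (\<lambda>n. closure (V n)))"
        by blast
    qed
    ultimately show False
      by simp
  qed
  then obtain n x0 where "x0 \<in> interior (closure (V n))"
    by blast
  then obtain r where r: "0 < r" "ball x0 r \<subseteq> closure (V n)"
    by (meson mem_interior)
  define M where "M = 4 * real n / r"
  have M: "0 \<le> M"
    using r(1) by (simp add: M_def)
  have approx: "\<exists>v. norm (y - v) < \<epsilon> \<and> (\<forall>A. finite A \<longrightarrow> norm (P A v) \<le> M * norm y)"
    if \<epsilon>: "0 < \<epsilon>" for y \<epsilon>
  proof (cases "y = 0")
    case True
    have "P A 0 = 0" for A
      using P_scaleR[of A 0 0] by simp
    then show ?thesis
      using True \<epsilon> by (intro exI[of _ 0]) simp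
  next
    case False
    \<comment> \<open>The scaled vector \<open>t *\<^sub>R y\<close> has norm \<open>r / 2\<close>, so it is a difference of two points of the ball.\<close>
    define t where "t = r / (2 * norm y)"
    have t: "0 < t"
      using r(1) False by (simp add: t_def)
    have "norm (t *\<^sub>R y) = r / 2"
      using False r(1) by (simp add: t_def)
    then have "x0 + t *\<^sub>R y \<in> closure (V n)" "x0 \<in> closure (V n)"
      using r by (auto simp: dist_norm intro!: subsetD[OF r(2)])
    moreover have "0 < t * \<epsilon> / 2"
      using t \<epsilon> by simp
    ultimately obtain p q where pq: "p \<in> V n" "dist p (x0 + t *\<^sub>R y) < t * \<epsilon> / 2"
      "q \<in> V n" "dist q x0 < t * \<epsilon> / 2"
      unfolding closure_approachable by metis
    let ?v = "(1 / t) *\<^sub>R (p - q)"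
    have "y - ?v = (1 / t) *\<^sub>R ((q - x0) - (p - (x0 + t *\<^sub>R y)))"
      using t by (simp add: algebra_simps)
    then have "norm (y - ?v) = (1 / t) * norm ((q - x0) - (p - (x0 + t *\<^sub>R y)))"
      using t by simp
    also have "\<dots> < (1 / t) * (t * \<epsilon>)"
      using pq norm_triangle_ineq4[of "q - x0" "p - (x0 + t *\<^sub>R y)"] t
      by (intro mult_strict_left_mono) (auto simp: dist_norm)
    finally have "norm (y - ?v) < \<epsilon>"
      using t by simp
    moreover have "norm (P A ?v) \<le> M * norm y" if "finite A" for A
    proof -
      have "norm (P A p - P A q) \<le> 2 * real n"
        using pq(1,3) that norm_triangle_ineq4[of "P A p" "P A q"] by (fastforce simp: V_def)
      then have "(1 / t) * norm (P A p - P A q) \<le> (1 / t) * (2 * real n)"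
        using t by (intro mult_left_mono) auto
      also have "\<dots> = M * norm y"
        using False r(1) by (simp add: M_def t_def)
      finally show ?thesis
        using t by (simp only: P_scaleR P_diff norm_scaleR) simp
    qed
    ultimately show ?thesis
      by blast
  qed
  then have "\<forall>y \<epsilon>. \<exists>v. 0 < \<epsilon> \<longrightarrow> norm (y - v) < \<epsilon> \<and> (\<forall>A. finite A \<longrightarrow> norm (P A v) \<le> M * norm y)"
    by blast
  then obtain v where v: "\<And>y \<epsilon>. 0 < \<epsilon> \<Longrightarrow> norm (y - v y \<epsilon>) < \<epsilon>"
    "\<And>y \<epsilon> A. 0 < \<epsilon> \<Longrightarrow> finite A \<Longrightarrow> norm (P A (v y \<epsilon>)) \<le> M * norm y"
    by metis
  have bound: "norm (P A x) \<le> 2 * M * norm x" if A: "finite A" for A x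
  proof (cases "x = 0")
    case True
    then show ?thesis
      using P_scaleR[of A 0 0] by simp
  next
    case False
    \<comment> \<open>Each step halves the remaining error, at a cost proportional to that error.\<close>
    define s where "s = rec_nat 0 (\<lambda>k s. s + v (x - s) (norm x / 2 ^ Suc k))"
    have s0: "s 0 = 0" and s_Suc: "s (Suc k) = s k + v (x - s k) (norm x / 2 ^ Suc k)" for k
      by (simp_all add: s_def)
    have near: "norm (x - s k) \<le> norm x / 2 ^ k" for k
    proof (cases k)
      case (Suc l)
      have "norm (x - s l - v (x - s l) (norm x / 2 ^ Suc l)) < norm x / 2 ^ Suc l"
        using False by (intro v) simp
      then show ?thesis
        by (simp add: Suc s_Suc algebra_simps)
    qed (simp add: s0)
    have step: "norm (P A (s (Suc k)) - P A (s k)) \<le> M * (norm x / 2 ^ k)" if "finite A" for A k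
    proof -
      have "P A (s (Suc k)) - P A (s k) = P A (v (x - s k) (norm x / 2 ^ Suc k))"
        by (simp add: s_Suc P_diff[symmetric])
      also have "norm \<dots> \<le> M * norm (x - s k)"
        using False that by (intro v) simp
      also have "\<dots> \<le> M * (norm x / 2 ^ k)"
        by (rule mult_left_mono[OF near M])
      finally show ?thesis .
    qed
    have diff: "norm (P A (s (k + l)) - P A (s k)) \<le> 2 * M * norm x / 2 ^ k" if "finite A" for A k l
    proof -
      have "norm (P A (s (k + l)) - P A (s k)) \<le> 2 * M * norm x * (1 / 2 ^ k - 1 / 2 ^ (k + l))"
      proof (induction l)
        case (Suc l)
        have "norm (P A (s (k + Suc l)) - P A (s k)) \<le>
            norm (P A (s (Suc (k + l))) - P A (s (k + l))) + norm (P A (s (k + l)) - P A (s k))"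
          using norm_triangle_ineq[of "P A (s (Suc (k + l))) - P A (s (k + l))" "P A (s (k + l)) - P A (s k)"]
          by simp
        also have "\<dots> \<le> M * (norm x / 2 ^ (k + l)) + 2 * M * norm x * (1 / 2 ^ k - 1 / 2 ^ (k + l))"
          by (rule add_mono[OF step[OF that] Suc.IH])
        also have "\<dots> = 2 * M * norm x * (1 / 2 ^ k - 1 / 2 ^ (k + Suc l))"
          by (simp add: field_simps)
        finally show ?case .
      qed simp
      also have "\<dots> \<le> 2 * M * norm x * (1 / 2 ^ k)"
        using M by (intro mult_left_mono) auto
      finally show ?thesis
        by simp
    qed
    have zero: "(\<lambda>k. C / 2 ^ k) \<longlonglongrightarrow> 0" for C :: real
      by (rule LIMSEQ_divide_realpow_zero) simp
    have lim: "s \<longlonglongrightarrow> x"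
    proof (rule metric_LIMSEQ_I)
      fix \<epsilon> :: real
      assume "0 < \<epsilon>"
      then obtain N where "\<And>k. k \<ge> N \<Longrightarrow> norm (norm x / 2 ^ k - 0) < \<epsilon>"
        using LIMSEQ_D[OF zero[of "norm x"]] by blast
      then show "\<exists>N. \<forall>k\<ge>N. dist (s k) x < \<epsilon>"
        using near by (intro exI[of _ N]) (fastforce simp: dist_norm norm_minus_commute intro: le_less_trans)
    qed
    have "\<exists>b. (\<lambda>i. sc (b i) (e i)) sums x \<and> (\<forall>i. (\<lambda>k. c (s k) i) \<longlonglongrightarrow> b i)"
    proof (rule limit_of_expansions[OF nz c_sums lim])
      fix \<epsilon> :: real
      assume "0 < \<epsilon>"
      then obtain N where "norm (4 * M * norm x / 2 ^ N - 0) < \<epsilon>"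
        using LIMSEQ_D[OF zero[of "4 * M * norm x"]] by blast
      then have N: "4 * M * norm x / 2 ^ N < \<epsilon>"
        using abs_ge_self[of "4 * M * norm x / 2 ^ N"] unfolding real_norm_def diff_0_right by linarith
      have "norm (\<Sum>i\<in>A. sc (c (s m) i - c (s n) i) (e i)) \<le> \<epsilon>"
        if "m \<ge> N" "n \<ge> N" "finite A" for m n A
      proof -
        have "(\<Sum>i\<in>A. sc (c (s m) i - c (s n) i) (e i)) = (P A (s m) - P A (s N)) - (P A (s n) - P A (s N))"
          by (simp add: P_def scale_left_diff_distrib sum_subtractf)
        also have "norm \<dots> \<le> norm (P A (s m) - P A (s N)) + norm (P A (s n) - P A (s N))"
          by (rule norm_triangle_ineq4)
        also have "\<dots> \<le> 2 * M * norm x / 2 ^ N + 2 * M * norm x / 2 ^ N"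
          using diff[OF that(3), of N "m - N"] diff[OF that(3), of N "n - N"] that by simp
        finally show ?thesis
          using N by simp
      qed
      then show "\<exists>N. \<forall>m\<ge>N. \<forall>n\<ge>N. \<forall>A. finite A \<longrightarrow> norm (\<Sum>i\<in>A. sc (c (s m) i - c (s n) i) (e i)) \<le> \<epsilon>"
        by blast
    qed
    then obtain b where b: "(\<lambda>i. sc (b i) (e i)) sums x" "\<And>i. (\<lambda>k. c (s k) i) \<longlonglongrightarrow> b i"
      by blast
    have "(\<lambda>k. P A (s k)) \<longlonglongrightarrow> P A x"
      unfolding P_def c_eqI[OF b(1)] by (intro tendsto_sum sc.tendsto b(2) tendsto_const)
    then have "(\<lambda>k. norm (P A (s k))) \<longlonglongrightarrow> norm (P A x)"
      by (rule tendsto_norm)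
    moreover have "norm (P A (s k)) \<le> 2 * M * norm x" for k
      using diff[OF A, of 0 k] P_scaleR[of A 0 0] by (simp add: s0)
    ultimately show ?thesis
      by (intro Lim_bounded[of _ _ 0]) auto
  qed
  have "norm u \<le> (2 * M) * norm (u + v)"
    if IJ: "I \<inter> J = {}" and uI: "u \<in> span (e ` I)" and vJ: "v \<in> span (e ` J)" for I J u v
  proof -
    obtain a where a: "(\<lambda>i. sc (a i) (e i)) sums u" "finite {i. a i \<noteq> 0}" "{i. a i \<noteq> 0} \<subseteq> I"
      by (rule expansion_of_span[OF uI])
    obtain b where b: "(\<lambda>i. sc (b i) (e i)) sums v" "finite {i. b i \<noteq> 0}" "{i. b i \<noteq> 0} \<subseteq> J"
      by (rule expansion_of_span[OF vJ])
    let ?A = "{i. a i \<noteq> 0}"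
    have "c (u + v) = (\<lambda>i. a i + b i)"
      by (rule c_eqI) (auto simp: scale_left_distrib intro: sums_add a b)
    then have "P ?A (u + v) = (\<Sum>i\<in>?A. sc (a i) (e i))"
      unfolding P_def using b(3) a(3) IJ by (intro sum.cong) auto
    also have "\<dots> = u"
      using sums_finite[OF a(2), of "\<lambda>i. sc (a i) (e i)"] a(1) by (auto intro: sums_unique2)
    finally show ?thesis
      using bound[OF a(2), of "u + v"] by simp
  qed
  then show thesis
    using that nz unfolding uncond_def by blast
qed


section \<open>Block sequences\<close>

lemma span_scaleR: "x \<in> span S \<Longrightarrow> r *\<^sub>R x \<in> span S"
  using span_scale[of x S "r *\<^sub>R 1"] by (simp only: scale_real)

text \<open>
  Splitting the vectors of an unconditional sequence into two sets splits its span. The pieces are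
  arbitrary subsets of the range, possibly finite or empty, so they are given as sets of vectors.
\<close>

lemma uncond_split_lin_isomorphic:
  assumes z: "uncond z K" and "S \<union> T = range z" and "S \<inter> T = {}"
  shows "lin_isomorphic (module_prod.scale sc sc) (cspan S \<times> cspan T) sc (cspan (range z))"
proof -
  have preimage: "U = z ` {i. z i \<in> U}" if "U \<subseteq> range z" for U
    using that by auto
  have ST: "S = z ` {i. z i \<in> S}" "T = z ` {i. z i \<in> T}"
    using assms(2) by (intro preimage; blast)+
  have disj: "{i. z i \<in> S} \<inter> {i. z i \<in> T} = {}" "{i. z i \<in> T} \<inter> {i. z i \<in> S} = {}"
    using assms(3) by blast+
  have "norm u \<le> K * norm (u + v) \<and> norm v \<le> K * norm (u + v)"
    if uv: "u \<in> span S" "v \<in> span T" for u v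
  proof -
    have uv': "u \<in> span (z ` {i. z i \<in> S})" "v \<in> span (z ` {i. z i \<in> T})"
      using uv ST by simp_all
    show ?thesis
      using uncond_norm_le[OF z disj(1) uv'] uncond_norm_le[OF z disj(2) uv'(2,1)]
      by (simp add: add.commute)
  qed
  from cspan_Un_lin_isomorphic[of S T K, OF this] show ?thesis
    using assms(2) by simp
qed

text \<open>
  Block-sequences without normalization, with supports confined to consecutive intervals
  of indices. The intervals compose, so blocks of blocks are blocks.
\<close>

definition blocks :: "(nat \<Rightarrow> 'a) \<Rightarrow> (nat \<Rightarrow> 'a) \<Rightarrow> bool" where
  "blocks e y \<longleftrightarrow>
     (\<exists>p::nat \<Rightarrow> nat. strict_mono p \<and> (\<forall>n. y n \<in> span (e ` {p n..<p (Suc n)}) \<and> y n \<noteq> 0))"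

lemma blocksE:
  assumes "blocks e y"
  obtains p :: "nat \<Rightarrow> nat"
  where "strict_mono p" "\<forall>n. y n \<in> span (e ` {p n..<p (Suc n)})" "\<forall>n. y n \<noteq> 0"
  using assms unfolding blocks_def by auto

lemma block_sequence_iff:
  assumes e: "uncond e K"
  shows "block_sequence sc e y \<longleftrightarrow> blocks e y \<and> (\<forall>n. norm (y n) = 1)"
proof
  assume y: "block_sequence sc e y"
  then have y1: "norm (y n) = 1" and yf: "y n \<in> finitely_supported sc e"
    and y_lt: "Max (supp sc e (y n)) < Min (supp sc e (y (Suc n)))" for n
    by (auto simp: block_sequence_def)
  have y_cspan: "y n \<in> cspan (range e)" and fin: "finite (supp sc e (y n))" for n
    using yf[of n] by (auto simp: finitely_supported_def closed_span_eq)
  have ne: "supp sc e (y n) \<noteq> {}" for n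
    using supp_nonempty[OF e] yf[of n] y1[of n] unfolding finitely_supported_eq_span[OF e] by force
  define p where "p n = Min (supp sc e (y n))" for n
  have lt: "i < p (Suc n)" if "i \<in> supp sc e (y n)" for i n
    using Max_ge[OF fin that] y_lt[of n] unfolding p_def by linarith
  have supp: "supp sc e (y n) \<subseteq> {p n..<p (Suc n)}" for n
    using lt fin by (auto simp: p_def)
  then have "p n < p (Suc n)" for n
    using ne[of n] by fastforce
  then have "strict_mono p"
    by (simp add: strict_mono_Suc_iff)
  moreover have "y n \<in> span (e ` {p n..<p (Suc n)})" for n
    using span_supp[OF e y_cspan fin] span_mono[OF image_mono[OF supp]] by blast
  moreover have "y n \<noteq> 0" for n
    using y1[of n] by auto
  ultimately show "blocks e y \<and> (\<forall>n. norm (y n) = 1)"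
    using y1 unfolding blocks_def by blast
next
  assume y: "blocks e y \<and> (\<forall>n. norm (y n) = 1)"
  obtain p :: "nat \<Rightarrow> nat" where "strict_mono p"
    "\<forall>n. y n \<in> span (e ` {p n..<p (Suc n)})" "\<forall>n. y n \<noteq> 0"
    by (rule blocksE[OF conjunct1[OF y]])
  note p = this(1) this(2,3)[rule_format]
  have range: "y n \<in> span (range e)" for n
    using p(2)[of n] span_mono[of "e ` {p n..<p (Suc n)}" "range e"] by blast
  have supp: "finite (supp sc e (y n))" "supp sc e (y n) \<subseteq> {p n..<p (Suc n)}" "supp sc e (y n) \<noteq> {}" for n
    using supp_span[OF e p(2)] supp_nonempty[OF e range p(3)] by auto
  have "Max (supp sc e (y n)) < Min (supp sc e (y (Suc n)))" for n
  proof -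
    have "Max (supp sc e (y n)) < p (Suc n)"
      using supp[of n] by (auto simp: Max_less_iff)
    also have "\<dots> \<le> Min (supp sc e (y (Suc n)))"
      using supp[of "Suc n"] by (auto simp: Min_ge_iff)
    finally show ?thesis .
  qed
  then show "block_sequence sc e y"
    using y range by (simp add: block_sequence_def finitely_supported_eq_span[OF e])
qed

lemma strict_mono_intervals_disjoint:
  fixes p :: "nat \<Rightarrow> nat"
  assumes "strict_mono p" "i \<in> {p m..<p (Suc m)}" "i \<in> {p n..<p (Suc n)}"
  shows "m = n"
proof (rule ccontr)
  assume "m \<noteq> n"
  then have "Suc m \<le> n \<or> Suc n \<le> m"
    by linarith
  then have "p (Suc m) \<le> p n \<or> p (Suc n) \<le> p m"
    by (simp add: strict_mono_less_eq[OF assms(1)])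
  then show False
    using assms(2,3) by auto
qed

lemma blocks_span:
  assumes "\<And>n. y n \<in> span (e ` {p n..<p (Suc n)})"
  shows "span (y ` I) \<subseteq> span (e ` (\<Union>n\<in>I. {p n..<p (Suc n)}))"
proof (intro span_minimal subspace_span image_subsetI)
  fix n
  assume "n \<in> I"
  then show "y n \<in> span (e ` (\<Union>n\<in>I. {p n..<p (Suc n)}))"
    using assms[of n] span_mono[of "e ` {p n..<p (Suc n)}" "e ` (\<Union>n\<in>I. {p n..<p (Suc n)})"] by blast
qed

lemma blocks_uncond:
  assumes e: "uncond e K" and y: "blocks e y"
  shows "uncond y K"
proof -
  obtain p :: "nat \<Rightarrow> nat" where "strict_mono p"
    "\<forall>n. y n \<in> span (e ` {p n..<p (Suc n)})" "\<forall>n. y n \<noteq> 0"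
    by (rule blocksE[OF y])
  note p = this(1) this(2,3)[rule_format]
  have "norm u \<le> K * norm (u + v)"
    if IJ: "I \<inter> J = {}" and u: "u \<in> span (y ` I)" and v: "v \<in> span (y ` J)" for I J u v
  proof (rule uncond_norm_le[OF e])
    show "u \<in> span (e ` (\<Union>n\<in>I. {p n..<p (Suc n)}))" "v \<in> span (e ` (\<Union>n\<in>J. {p n..<p (Suc n)}))"
      using blocks_span[of y e p, OF p(2)] u v by blast+
    show "(\<Union>n\<in>I. {p n..<p (Suc n)}) \<inter> (\<Union>n\<in>J. {p n..<p (Suc n)}) = {}"
      using strict_mono_intervals_disjoint[OF p(1)] IJ by blast
  qed
  then show ?thesis
    using p(3) unfolding uncond_def by blast
qed

lemma blocks_range_subset:
  assumes "blocks e y"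
  shows "range y \<subseteq> span (range e)"
proof -
  obtain p :: "nat \<Rightarrow> nat" where "strict_mono p"
    "\<forall>n. y n \<in> span (e ` {p n..<p (Suc n)})" "\<forall>n. y n \<noteq> 0"
    by (rule blocksE[OF assms])
  note p = this(1) this(2,3)[rule_format]
  have "y n \<in> span (range e)" for n
    using p(2)[of n] span_mono[of "e ` {p n..<p (Suc n)}" "range e"] by blast
  then show ?thesis
    by blast
qed

lemma blocks_trans:
  assumes "blocks e y" and "blocks y z"
  shows "blocks e z"
proof -
  obtain p :: "nat \<Rightarrow> nat" where "strict_mono p"
    "\<forall>n. y n \<in> span (e ` {p n..<p (Suc n)})" "\<forall>n. y n \<noteq> 0"
    by (rule blocksE[OF assms(1)])
  note p = this(1) this(2,3)[rule_format]
  obtain q :: "nat \<Rightarrow> nat" where "strict_mono q"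
    "\<forall>n. z n \<in> span (y ` {q n..<q (Suc n)})" "\<forall>n. z n \<noteq> 0"
    by (rule blocksE[OF assms(2)])
  note q = this(1) this(2,3)[rule_format]
  have "z n \<in> span (e ` {p (q n)..<p (q (Suc n))})" for n
  proof -
    have "p (q n) \<le> p k \<and> p (Suc k) \<le> p (q (Suc n))" if "k \<in> {q n..<q (Suc n)}" for k
      using that by (simp add: strict_mono_less_eq[OF p(1)])
    then have "(\<Union>k\<in>{q n..<q (Suc n)}. {p k..<p (Suc k)}) \<subseteq> {p (q n)..<p (q (Suc n))}"
      by fastforce
    from span_mono[OF image_mono[OF this]] show ?thesis
      using q(2)[of n] blocks_span[of y e p "{q n..<q (Suc n)}", OF p(2)] by blast
  qed
  moreover have "strict_mono (p \<circ> q)"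
    using p(1) q(1) by (rule strict_mono_o)
  ultimately show ?thesis
    unfolding blocks_def using q(3) by (intro exI[of _ "p \<circ> q"]) simp
qed

lemma span_rescale:
  fixes r :: "nat \<Rightarrow> real"
  assumes "\<And>n. r n \<noteq> 0"
  shows "span ((\<lambda>n. r n *\<^sub>R y n) ` I) = span (y ` I)"
proof
  show "span ((\<lambda>n. r n *\<^sub>R y n) ` I) \<subseteq> span (y ` I)"
    by (intro span_minimal subspace_span image_subsetI span_scaleR span_base imageI)
  have "y n \<in> span ((\<lambda>n. r n *\<^sub>R y n) ` I)" if "n \<in> I" for n
  proof -
    have "(1 / r n) *\<^sub>R (r n *\<^sub>R y n) \<in> span ((\<lambda>n. r n *\<^sub>R y n) ` I)"
      using that by (intro span_scaleR span_base imageI)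
    then show ?thesis
      using assms by simp
  qed
  then show "span (y ` I) \<subseteq> span ((\<lambda>n. r n *\<^sub>R y n) ` I)"
    by (intro span_minimal subspace_span image_subsetI)
qed

lemma blocks_rescale_basis:
  fixes r :: "nat \<Rightarrow> real"
  assumes "\<And>n. r n \<noteq> 0"
  shows "blocks (\<lambda>n. r n *\<^sub>R e n) y \<longleftrightarrow> blocks e y"
  unfolding blocks_def by (simp add: span_rescale[OF assms])

lemma blocks_rescale:
  fixes r :: "nat \<Rightarrow> real"
  assumes "\<And>n. r n \<noteq> 0" and "blocks e y"
  shows "blocks e (\<lambda>n. r n *\<^sub>R y n)"
  using assms unfolding blocks_def by (metis scaleR_eq_0_iff span_scaleR)

lemma blocks_refl:
  assumes "uncond e K"
  shows "blocks e e"
  unfolding blocks_def using uncond_nonzero[OF assms]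
  by (intro exI[of _ id]) (auto intro!: strict_monoI span_base)

lemma blocks_normalize:
  assumes e: "uncond e K" and y: "blocks e y"
  obtains y' where "block_sequence sc e y'" and "cspan (range y') = cspan (range y)"
    and "\<And>z. blocks y' z \<longleftrightarrow> blocks y z"
proof
  let ?r = "\<lambda>n. 1 / norm (y n)" and ?y = "\<lambda>n. (1 / norm (y n)) *\<^sub>R y n"
  have nz: "norm (y n) \<noteq> 0" for n
    using uncond_nonzero[OF blocks_uncond[OF e y]] by simp
  then have r: "?r n \<noteq> 0" for n
    by simp
  show "block_sequence sc e ?y"
    using blocks_rescale[OF r y] nz by (simp add: block_sequence_iff[OF e])
  show "cspan (range ?y) = cspan (range y)"
    using span_rescale[OF r, where y=y and I=UNIV] by (simp add: cspan_def)
  show "blocks ?y z \<longleftrightarrow> blocks y z" for z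
    by (rule blocks_rescale_basis[OF r])
qed


section \<open>Small perturbations\<close>

text \<open>
  The map \<open>f\<close> adds to \<open>T x\<close> the errors \<open>w i - T (y i)\<close>, weighted by the coordinates of \<open>x\<close>. These
  coordinates are bounded by \<open>norm x\<close>, and the geometric decay makes the total change at most half
  of the lower bound of \<open>T\<close>, so \<open>f\<close> is still an embedding.
\<close>

lemma perturb_embedding:
  assumes y: "uncond y K" and T: "linear_embedding sc (cspan (range y)) sc T"
    and m: "0 < m" "\<And>x. x \<in> cspan (range y) \<Longrightarrow> m * norm x \<le> norm (T x)"
    and w: "\<And>i. norm (w i - T (y i)) \<le> m / (4 * K) * norm (y i) * (1 / 2) ^ i"
  obtains f where "linear_embedding sc (cspan (range y)) sc f" and "\<forall>i. f (y i) = w i"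
proof -
  let ?S = "cspan (range y)"
  obtain M where M: "\<And>x. x \<in> ?S \<Longrightarrow> norm (T x) \<le> M * norm x"
    and T_add: "\<And>x z. x \<in> ?S \<Longrightarrow> z \<in> ?S \<Longrightarrow> T (x + z) = T x + T z"
    and T_sc: "\<And>c x. x \<in> ?S \<Longrightarrow> T (sc c x) = sc c (T x)"
    using T unfolding linear_embedding_def by blast
  have K: "0 < K"
    using uncond_ge_1[OF y] by simp
  define t where "t x i = sc (coords sc y x i) (w i - T (y i))" for x i
  have t_le: "norm (t x i) \<le> (m / 4 * norm x) * (1 / 2) ^ i" if x: "x \<in> ?S" for x i
  proof -
    have "norm (t x i) \<le> norm (coords sc y x i) * (m / (4 * K) * norm (y i) * (1 / 2) ^ i)"
      unfolding t_def norm_scale by (rule mult_left_mono[OF w norm_ge_zero])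
    also have "\<dots> = m / (4 * K) * (1 / 2) ^ i * (norm (coords sc y x i) * norm (y i))"
      by simp
    also have "\<dots> \<le> m / (4 * K) * (1 / 2) ^ i * (K * norm x)"
      using coords_bound[OF y x] m(1) K by (intro mult_left_mono) auto
    finally show ?thesis
      using K by (simp add: mult_ac)
  qed
  have geo: "(\<lambda>i. (m / 4 * norm x) * (1 / 2) ^ i) sums (m / 2 * norm x)" for x :: 'a
    using sums_mult[OF geometric_sums[of "1 / 2 :: real"], of "m / 4 * norm x"] by simp
  have t_sums: "summable (t x)" if "x \<in> ?S" for x
    by (rule summable_comparison_test'[OF sums_summable[OF geo] t_le[OF that]])
  have t_norm: "norm (suminf (t x)) \<le> m / 2 * norm x" if "x \<in> ?S" for x
    unfolding sums_unique[OF geo[of x]] by (rule norm_suminf_le[OF t_le[OF that] sums_summable[OF geo]])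
  define f where "f x = T x + suminf (t x)" for x
  have "f (x + z) = f x + f z" if "x \<in> ?S" "z \<in> ?S" for x z
  proof -
    have "t (x + z) = (\<lambda>i. t x i + t z i)"
      using that by (simp add: t_def fun_eq_iff coords_add[OF y] scale_left_distrib)
    then show ?thesis
      using that by (simp add: f_def T_add suminf_add[OF t_sums t_sums, symmetric])
  qed
  moreover have "f (sc c x) = sc c (f x)" if "x \<in> ?S" for c x
  proof -
    have "t (sc c x) = (\<lambda>i. sc c (t x i))"
      using that by (simp add: t_def fun_eq_iff coords_scale[OF y])
    then show ?thesis
      using that bounded_linear.suminf[OF sc.bounded_linear_right t_sums[OF that], of c]
      by (simp add: f_def T_sc scale_right_distrib)
  qed
  moreover have "m / 2 * norm x \<le> norm (f x)" if "x \<in> ?S" for x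
    using m(2)[OF that] t_norm[OF that] norm_triangle_ineq4[of "f x" "suminf (t x)"]
    by (simp add: f_def field_simps)
  moreover have "norm (f x) \<le> (M + m / 2) * norm x" if "x \<in> ?S" for x
    using M[OF that] t_norm[OF that] norm_triangle_ineq[of "T x" "suminf (t x)"]
    by (simp add: f_def distrib_right)
  ultimately have "linear_embedding sc ?S sc f"
    unfolding linear_embedding_def using m(1) half_gt_zero by blast
  moreover have "f (y i) = w i" for i
  proof -
    have "t (y i) = (\<lambda>k. if k = i then w i - T (y i) else 0)"
      by (auto simp: t_def coords_basis[OF y])
    then have "suminf (t (y i)) = w i - T (y i)"
      using sums_unique[OF sums_single[of i "\<lambda>_. w i - T (y i)"]] by simp
    then show ?thesis
      by (simp add: f_def)
  qed
  ultimately show thesis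
    using that by blast
qed

lemma linear_embedding_id: "linear_embedding sc S sc (\<lambda>x. x)"
  unfolding linear_embedding_def by (auto intro: exI[of _ 1])

lemma zero_rational_scalars: "(0 :: 'k) \<in> rational_scalars"
  unfolding rational_scalars_def by (intro CollectI exI[of _ 0]) simp

text \<open>
  The nearby rational vector has norm close to \<open>1\<close>, so normalizing it moves it only a
  little further. Changing only the coefficients on \<open>A\<close> keeps approximations of blocks in block
  position.
\<close>

lemma rational_block_near:
  assumes e: "uncond e K" and y: "y \<in> span (e ` A)" "norm y = 1" and A: "finite A" and \<epsilon>: "0 < \<epsilon>"
  obtains w where "w \<in> rational_blocks sc e" "w \<in> span (e ` A)" "norm (w - y) \<le> \<epsilon>"
proof -
  let ?c = "coords sc e y"
  have yc: "y \<in> cspan (range e)"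
    using y(1) span_mono[of "e ` A" "range e"] span_subset_cspan by blast
  have y_sum: "y = (\<Sum>i\<in>A. sc (?c i) (e i))"
    by (rule sum_coords[OF e yc A supp_span(2)[OF e y(1)]])
  define \<eta> where "\<eta> = min (\<epsilon> / 2) (1 / 2)"
  have \<eta>: "0 < \<eta>" "\<eta> \<le> 1 / 2" "\<eta> + \<eta> \<le> \<epsilon>"
    using \<epsilon> by (auto simp: \<eta>_def)
  define C where "C = (\<Sum>i\<in>A. norm (e i)) + 1"
  have C: "0 < C" "(\<Sum>i\<in>A. norm (e i)) \<le> C"
    unfolding C_def using sum_nonneg[of A "\<lambda>i. norm (e i)"] by auto
  have "\<forall>i. \<exists>q\<in>rational_scalars. norm (q - ?c i) < \<eta> / C"
    using \<eta>(1) C(1) by (intro allI rational_scalars_dense) simp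
  then obtain q where q: "\<And>i. q i \<in> rational_scalars" "\<And>i. norm (q i - ?c i) < \<eta> / C"
    by metis
  define z where "z = (\<Sum>i\<in>A. sc (q i) (e i))"
  have z_span: "z \<in> span (e ` A)"
    unfolding z_def by (rule sum_in_span) simp
  have "z - y = (\<Sum>i\<in>A. sc (q i - ?c i) (e i))"
    by (subst y_sum) (simp add: z_def sum_subtractf scale_left_diff_distrib)
  also have "norm \<dots> \<le> (\<Sum>i\<in>A. norm (q i - ?c i) * norm (e i))"
    using norm_sum[of "\<lambda>i. sc (q i - ?c i) (e i)" A] by (simp add: norm_scale)
  also have "\<dots> \<le> (\<Sum>i\<in>A. \<eta> / C * norm (e i))"
    by (intro sum_mono mult_right_mono less_imp_le q(2) norm_ge_zero)
  also have "\<dots> \<le> \<eta> / C * C"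
    unfolding sum_distrib_left[symmetric] using C \<eta>(1) by (intro mult_left_mono) auto
  finally have zy: "norm (z - y) \<le> \<eta>"
    using C(1) by simp
  have z1: "\<bar>norm z - 1\<bar> \<le> \<eta>"
    using zy y(2) norm_triangle_ineq3[of z y] by linarith
  then have z0: "0 < norm z"
    using \<eta>(2) by linarith
  define w where "w = (1 / norm z) *\<^sub>R z"
  have w1: "norm w = 1"
    using z0 by (simp add: w_def)
  have "norm z *\<^sub>R w = z"
    using z0 by (simp add: w_def)
  then have "norm (w - z) = norm ((1 - norm z) *\<^sub>R w)"
    by (simp only: scaleR_left_diff_distrib scaleR_one)
  also have "\<dots> \<le> \<eta>"
    using z1 w1 by (simp add: abs_minus_commute)
  finally have "norm (w - z) \<le> \<eta>" .
  then have wy: "norm (w - y) \<le> \<epsilon>"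
    using zy \<eta>(3) norm_triangle_ineq[of "w - z" "z - y"] by simp
  have w_span: "w \<in> span (e ` A)"
    unfolding w_def by (rule span_scaleR[OF z_span])
  have "(\<lambda>i. sc (if i \<in> A then q i else 0) (e i)) sums (\<Sum>i\<in>A. sc (if i \<in> A then q i else 0) (e i))"
    using A by (intro sums_finite) auto
  then have "coords sc e z = (\<lambda>i. if i \<in> A then q i else 0)"
    by (intro coords_eqI[OF e]) (simp add: z_def cong: sum.cong)
  then have "coords sc e z i \<in> rational_scalars" for i
    using q(1) zero_rational_scalars by simp
  then have "w \<in> rational_blocks sc e"
    unfolding rational_blocks_def finitely_supported_eq_span[OF e]
    using w_span z_span w1 w_def span_mono[of "e ` A" "range e"] by blast
  then show thesis
    using that w_span wy by blast
qed

lemma bbd_near: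
  fixes \<delta> :: "nat \<Rightarrow> real"
  assumes e: "uncond e K" and y: "block_sequence sc e y" and \<delta>: "\<And>i. 0 < \<delta> i"
  shows "\<exists>w\<in>bbd sc e. \<forall>i. norm (w i - y i) \<le> \<delta> i"
proof -
  have blocks: "blocks e y" and y1: "\<And>n. norm (y n) = 1"
    using y by (auto simp: block_sequence_iff[OF e])
  obtain p :: "nat \<Rightarrow> nat" where "strict_mono p"
    "\<forall>n. y n \<in> span (e ` {p n..<p (Suc n)})" "\<forall>n. y n \<noteq> 0"
    by (rule blocksE[OF blocks])
  note p = this(1) this(2,3)[rule_format]
  have "\<forall>n. \<exists>w. w \<in> rational_blocks sc e \<and> w \<in> span (e ` {p n..<p (Suc n)}) \<and> norm (w - y n) \<le> \<delta> n"
    using rational_block_near[OF e p(2) y1 _ \<delta>] by (metis finite_atLeastLessThan)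
  then obtain w where w: "\<And>n. w n \<in> rational_blocks sc e" "\<And>n. w n \<in> span (e ` {p n..<p (Suc n)})"
    "\<And>n. norm (w n - y n) \<le> \<delta> n"
    by metis
  have w1: "norm (w n) = 1" for n
    using w(1)[of n] by (simp add: rational_blocks_def)
  then have "w n \<noteq> 0" for n
    by (metis norm_zero zero_neq_one)
  then have "blocks e w"
    unfolding blocks_def using p(1) w(2) by blast
  then have "w \<in> bbd sc e"
    using w(1) w1 by (simp add: bbd_def block_sequence_iff[OF e])
  then show ?thesis
    using w(3) by blast
qed

lemma bbd_lin_isomorphic:
  assumes e: "uncond e K" and y: "block_sequence sc e y"
  obtains w where "w \<in> bbd sc e" and "lin_isomorphic sc (cspan (range y)) sc (cspan (range w))"
proof -
  have y': "uncond y K"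
    using blocks_uncond[OF e] y by (simp add: block_sequence_iff[OF e])
  let ?\<delta> = "\<lambda>i. 1 / (4 * K) * norm (y i) * (1 / 2) ^ i"
  have "0 < ?\<delta> i" for i
    using uncond_ge_1[OF e] uncond_nonzero[OF y', of i] by simp
  then obtain w where w: "w \<in> bbd sc e" "\<And>i. norm (w i - y i) \<le> ?\<delta> i"
    using bbd_near[OF e y, of ?\<delta>] by blast
  obtain f where f: "linear_embedding sc (cspan (range y)) sc f" "\<forall>i. f (y i) = w i"
    by (rule perturb_embedding[OF y' linear_embedding_id zero_less_one _ w(2)]) simp
  then have "f ` range y = range w"
    by (simp add: image_image)
  then show thesis
    using linear_embedding_cspan_lin_isomorphic[OF f(1)] that w(1) by simp
qed


section \<open>Rational block strings\<close>

text \<open>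
  Finite initial parts and finite pieces of rational block-sequences. The bounds on the supports
  make concatenation a matter of matching endpoints.
\<close>

definition block_string :: "(nat \<Rightarrow> 'a) \<Rightarrow> nat \<Rightarrow> nat \<Rightarrow> 'a list \<Rightarrow> bool" where
  "block_string e a b s \<longleftrightarrow>
     (\<forall>x\<in>set s. x \<in> rational_blocks sc e \<and> supp sc e x \<subseteq> {a..<b}) \<and>
     sorted_wrt (\<lambda>x y. Max (supp sc e x) < Min (supp sc e y)) s"

lemma rational_blocksD:
  assumes e: "uncond e K" and x: "x \<in> rational_blocks sc e"
  shows "norm x = 1" and "x \<in> span (range e)" and "finite (supp sc e x)" and "supp sc e x \<noteq> {}"
proof -
  show x1: "norm x = 1" and xs: "x \<in> span (range e)"
    using x by (auto simp: rational_blocks_def finitely_supported_eq_span[OF e])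
  have "x \<noteq> 0"
    using x1 by auto
  then show "finite (supp sc e x)" "supp sc e x \<noteq> {}"
    using supp_span(1)[OF e xs] supp_nonempty[OF e xs] by blast+
qed

lemma rational_block_at:
  assumes e: "uncond e K"
  obtains w where "w \<in> rational_blocks sc e" "supp sc e w = {i}"
proof -
  have ei: "e i \<noteq> 0"
    by (rule uncond_nonzero[OF e])
  have "(1 / norm (e i)) *\<^sub>R e i \<in> span (e ` {i})"
    by (intro span_scaleR span_base) simp
  moreover have "norm ((1 / norm (e i)) *\<^sub>R e i) = 1"
    using ei by simp
  ultimately obtain w where w: "w \<in> rational_blocks sc e" "w \<in> span (e ` {i})"
    using rational_block_near[OF e, of _ "{i}" 1] by (metis finite.emptyI finite_insert zero_less_one)
  then show thesis
    using that supp_span(2)[OF e w(2)] rational_blocksD(4)[OF e w(1)] by blast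
qed

lemma bbd_iff:
  assumes e: "uncond e K"
  shows "z \<in> bbd sc e \<longleftrightarrow> (\<forall>i. z i \<in> rational_blocks sc e) \<and>
    (\<forall>i. Max (supp sc e (z i)) < Min (supp sc e (z (Suc i))))"
  unfolding bbd_def block_sequence_def rational_blocks_def by blast

lemma bbd_uncond: "uncond e K \<Longrightarrow> z \<in> bbd sc e \<Longrightarrow> uncond z K"
  using blocks_uncond by (simp add: bbd_def block_sequence_iff)

lemma bbd_sorted:
  assumes e: "uncond e K" and z: "z \<in> bbd sc e" and "i < j"
  shows "Max (supp sc e (z i)) < Min (supp sc e (z j))"
  using \<open>i < j\<close>
proof (induction j)
  case (Suc j)
  have "finite (supp sc e (z j))" "supp sc e (z j) \<noteq> {}"
    using rational_blocksD[OF e] z by (auto simp: bbd_iff[OF e])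
  then have "Min (supp sc e (z j)) \<le> Max (supp sc e (z j))"
    by (meson Max_ge Min_in)
  moreover have "Max (supp sc e (z j)) < Min (supp sc e (z (Suc j)))"
    using z by (simp add: bbd_iff[OF e])
  ultimately show ?case
    using Suc by (cases "i = j") auto
qed simp

lemma block_string_Nil: "block_string e a b []"
  by (simp add: block_string_def)

lemma block_string_mono: "block_string e a b s \<Longrightarrow> a' \<le> a \<Longrightarrow> b \<le> b' \<Longrightarrow> block_string e a' b' s"
  unfolding block_string_def by fastforce

lemma block_string_append:
  assumes e: "uncond e K" and s: "block_string e a b s" and t: "block_string e b c t"
    and "a \<le> b" "b \<le> c"
  shows "block_string e a c (s @ t)"
proof -
  have "Max (supp sc e x) < Min (supp sc e y)" if "x \<in> set s" "y \<in> set t" for x y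
  proof -
    have x: "x \<in> rational_blocks sc e" "supp sc e x \<subseteq> {a..<b}" and y: "y \<in> rational_blocks sc e" "supp sc e y \<subseteq> {b..<c}"
      using s t that by (auto simp: block_string_def)
    have "Max (supp sc e x) < b"
      using Max_in[OF rational_blocksD(3,4)[OF e x(1)]] x(2) by auto
    also have "b \<le> Min (supp sc e y)"
      using Min_in[OF rational_blocksD(3,4)[OF e y(1)]] y(2) by auto
    finally show ?thesis .
  qed
  then have "sorted_wrt (\<lambda>x y. Max (supp sc e x) < Min (supp sc e y)) (s @ t)"
    using s t by (simp add: sorted_wrt_append block_string_def)
  moreover have "block_string e a c s" "block_string e a c t"
    using block_string_mono[OF s] block_string_mono[OF t] assms(4,5) by auto
  ultimately show ?thesis
    by (auto simp: block_string_def)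
qed

lemma sorted_wrt_map_upt:
  "(\<And>i j. m \<le> i \<Longrightarrow> i < j \<Longrightarrow> j < n \<Longrightarrow> R (f i) (f j)) \<Longrightarrow> sorted_wrt R (map f [m..<n])"
  by (simp add: sorted_wrt_iff_nth_less)

text \<open>
  A growing chain of strings determines an infinite block-sequence. Consecutive strings of the chain
  may coincide, which is how intervals left empty are accommodated later.
\<close>

lemma block_string_limit:
  assumes e: "uncond e K" and str: "\<And>k. \<exists>b. block_string e 0 b (P k)"
    and ext: "\<And>k. \<exists>t. P (Suc k) = P k @ t" and unbounded: "\<And>n. \<exists>k. n < length (P k)"
  obtains z where "z \<in> bbd sc e" and "\<forall>k. \<forall>i<length (P k). z i = P k ! i" and "range z = (\<Union>k. set (P k))"
proof -
  have prefix: "\<exists>t. P l = P k @ t" if "k \<le> l" for k l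
    using that
  proof (induction l rule: dec_induct)
    case (step l)
    then obtain t t' where "P l = P k @ t" "P (Suc l) = P l @ t'"
      using ext by blast
    then show ?case
      by simp
  qed simp
  have agree: "P k ! i = P l ! i" if "i < length (P k)" "i < length (P l)" for k l i
    using prefix[of k l] prefix[of l k] that by (metis nle_le nth_append)
  obtain \<kappa> where \<kappa>: "\<And>i. i < length (P (\<kappa> i))"
    using unbounded by metis
  define z where "z i = P (\<kappa> i) ! i" for i
  have z: "z i = P k ! i" if "i < length (P k)" for k i
    unfolding z_def using agree \<kappa> that by blast
  have "z i \<in> rational_blocks sc e \<and> Max (supp sc e (z i)) < Min (supp sc e (z (Suc i)))" for i
  proof -
    let ?k = "\<kappa> (Suc i)"
    obtain b where "block_string e 0 b (P ?k)"
      using str by blast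
    moreover have "z i = P ?k ! i" "z (Suc i) = P ?k ! Suc i" "Suc i < length (P ?k)"
      using \<kappa>[of "Suc i"] z by auto
    ultimately show ?thesis
      by (simp add: block_string_def sorted_wrt_iff_nth_less)
  qed
  then have "z \<in> bbd sc e"
    by (simp add: bbd_iff[OF e])
  moreover have "range z = (\<Union>k. set (P k))"
  proof
    show "range z \<subseteq> (\<Union>k. set (P k))"
      using \<kappa> unfolding z_def by (auto intro: nth_mem)
    show "(\<Union>k. set (P k)) \<subseteq> range z"
    proof
      fix x
      assume "x \<in> (\<Union>k. set (P k))"
      then obtain k i where "i < length (P k)" "x = P k ! i"
        by (auto simp: in_set_conv_nth)
      then show "x \<in> range z"
        using z[of i k] by (metis rangeI)
    qed
  qed
  ultimately show thesis
    using that z by blast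
qed

lemma block_string_extends:
  assumes e: "uncond e K" and s: "block_string e 0 b s"
  obtains z where "z \<in> bbd sc e" and "\<forall>i<length s. z i = s ! i"
proof -
  have "\<exists>w. w \<in> rational_blocks sc e \<and> supp sc e w = {i}" for i
    by (rule rational_block_at[OF e]) blast
  then obtain w where w: "\<And>i. w i \<in> rational_blocks sc e" "\<And>i. supp sc e (w i) = {i}"
    by metis
  define P where "P k = s @ map w [b..<b + k]" for k
  have "block_string e b (b + k) (map w [b..<b + k])" for k
    unfolding block_string_def using w by (auto intro!: sorted_wrt_map_upt)
  then have "block_string e 0 (b + k) (P k)" for k
    unfolding P_def using block_string_append[OF e s] by simp
  moreover have "\<exists>t. P (Suc k) = P k @ t" for k
    by (simp add: P_def)
  moreover have "\<exists>k. n < length (P k)" for n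
    by (rule exI[of _ "Suc n"]) (simp add: P_def)
  ultimately obtain z where "z \<in> bbd sc e" "\<forall>k. \<forall>i<length (P k). z i = P k ! i"
    using block_string_limit[OF e, of P] by metis
  moreover have "P 0 = s"
    by (simp add: P_def)
  ultimately show thesis
    using that by metis
qed


section \<open>Baire category in the space of block-sequences\<close>

lemma topspace_bbd_topology: "topspace (bbd_topology sc e) = bbd sc e"
  unfolding bbd_topology_def topspace_subtopology by (auto simp: bbd_def)

text \<open>
  Nowhere density in combinatorial form: any initial part of a block-sequence extends to one all of
  whose continuations avoid \<open>N\<close>. Basic open sets fix finitely many vectors, since each
  factor of the product is discrete.
\<close>

lemma nowhere_dense_bbd_avoid:
  assumes N: "nowhere_dense_in (bbd_topology sc e) N" and z: "z \<in> bbd sc e"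
  obtains z' m where "z' \<in> bbd sc e" "n \<le> m" "\<forall>i<n. z' i = z i"
    and "\<forall>v\<in>bbd sc e. (\<forall>i<m. v i = z' i) \<longrightarrow> v \<notin> N"
proof -
  let ?T = "bbd_topology sc e" and ?R = "rational_blocks sc e"
  let ?X = "product_topology (\<lambda>_::nat. discrete_topology ?R) UNIV"
  have bbd_R: "v i \<in> ?R" if "v \<in> bbd sc e" for v i
    using that by (simp add: bbd_def)
  define V where "V = {v \<in> bbd sc e. \<forall>i<n. v i = z i}"
  define B where "B = (\<Pi>\<^sub>E i\<in>UNIV. if i < n then {z i} else ?R)"
  have "finite {i. (if i < n then {z i} else ?R) \<noteq> ?R}"
    by (rule finite_subset[of _ "{..<n}"]) (auto split: if_splits)
  then have "openin ?X B"
    unfolding B_def openin_PiE_gen using bbd_R[OF z] by (auto simp: Collect_neg_eq)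
  moreover have "V = B \<inter> bbd sc e"
    unfolding V_def B_def using bbd_R by (auto simp: PiE_iff split: if_splits)
  ultimately have V: "openin ?T V"
    unfolding bbd_topology_def openin_subtopology by blast
  have "\<not> V \<subseteq> ?T closure_of N"
  proof
    assume "V \<subseteq> ?T closure_of N"
    then have "V \<subseteq> ?T interior_of (?T closure_of N)"
      using V by (rule interior_of_maximal)
    then show False
      using N z by (auto simp: nowhere_dense_in_def V_def)
  qed
  then obtain z' where z': "z' \<in> V" "z' \<notin> ?T closure_of N"
    by blast
  have "openin ?T (topspace ?T - ?T closure_of N)"
    by (intro openin_diff openin_topspace closedin_closure_of)
  then obtain U where U: "openin ?X U" "topspace ?T - ?T closure_of N = U \<inter> bbd sc e"
    unfolding bbd_topology_def openin_subtopology by blast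
  have z'_bbd: "z' \<in> bbd sc e" "\<forall>i<n. z' i = z i"
    using z'(1) by (auto simp: V_def)
  then have "z' \<in> U"
    using U(2) z'(2) by (auto simp: topspace_bbd_topology)
  then obtain W where W: "finite {i \<in> UNIV. W i \<noteq> topspace (discrete_topology ?R)}"
    "z' \<in> Pi\<^sub>E UNIV W" "Pi\<^sub>E UNIV W \<subseteq> U"
    using U(1) unfolding openin_product_topology_alt by meson
  then have "finite {i. W i \<noteq> ?R}"
    by simp
  then obtain l where l: "{i. W i \<noteq> ?R} \<subseteq> {..<l}"
    using finite_nat_iff_bounded by blast
  have "v \<notin> N" if v: "v \<in> bbd sc e" "\<forall>i<max n l. v i = z' i" for v
  proof -
    have "v i \<in> W i" for i
    proof (cases "W i = ?R")
      case True
      then show ?thesis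
        using bbd_R[OF v(1)] by simp
    next
      case False
      then have "i < l"
        using l by blast
      then show ?thesis
        using v(2) W(2) by (auto simp: PiE_iff)
    qed
    then have "v \<in> U"
      using W(3) by (auto simp: PiE_iff)
    then have "v \<notin> ?T closure_of N"
      using U(2) v(1) by blast
    moreover have "N \<subseteq> ?T closure_of N"
      using N closure_of_subset by (auto simp: nowhere_dense_in_def)
    ultimately show ?thesis
      by blast
  qed
  then show thesis
    using that[of z' "max n l"] z'_bbd by auto
qed

definition string_avoids :: "(nat \<Rightarrow> 'a) \<Rightarrow> (nat \<Rightarrow> 'a) set \<Rightarrow> 'a list \<Rightarrow> bool" where
  "string_avoids e N s \<longleftrightarrow> (\<forall>z\<in>bbd sc e. (\<forall>i<length s. z i = s ! i) \<longrightarrow> z \<notin> N)"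

lemma string_avoids_append: "string_avoids e N s \<Longrightarrow> string_avoids e N (s @ t)"
  unfolding string_avoids_def by (simp add: nth_append)

text \<open>
  A block supported at \<open>b\<close> is put in front of the part supplied by nowhere density, to force
  everything appended to \<open>s\<close> to be supported from \<open>b\<close> on, also when \<open>s\<close> is empty or ends early.
\<close>

lemma block_string_avoid:
  assumes e: "uncond e K" and N: "nowhere_dense_in (bbd_topology sc e) N" and s: "block_string e 0 b s"
  obtains t c where "b \<le> c" "block_string e b c t" "string_avoids e N (s @ t)"
proof -
  obtain w where w: "w \<in> rational_blocks sc e" "supp sc e w = {b}"
    by (rule rational_block_at[OF e])
  have "block_string e b (Suc b) [w]"
    using w by (simp add: block_string_def)
  then have "block_string e 0 (Suc b) (s @ [w])"
    using block_string_append[OF e s] by simp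
  then obtain z where z: "z \<in> bbd sc e" "\<forall>i<length (s @ [w]). z i = (s @ [w]) ! i"
    by (rule block_string_extends[OF e])
  obtain z' m where z': "z' \<in> bbd sc e" "length (s @ [w]) \<le> m" "\<forall>i<length (s @ [w]). z' i = z i"
    and avoid: "\<forall>v\<in>bbd sc e. (\<forall>i<m. v i = z' i) \<longrightarrow> v \<notin> N"
    by (rule nowhere_dense_bbd_avoid[OF N z(1)])
  define t where "t = map z' [length s..<m]"
  have z'_s: "z' i = (s @ [w]) ! i" if "i < length (s @ [w])" for i
    using z(2) z'(3) that by simp
  have st: "s @ t = map z' [0..<m]"
  proof (rule nth_equalityI)
    show "length (s @ t) = length (map z' [0..<m])"
      using z'(2) by (simp add: t_def)
    fix i
    assume "i < length (s @ t)"
    then show "(s @ t) ! i = map z' [0..<m] ! i"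
      using z'(2) z'_s[of i] by (auto simp: t_def nth_append)
  qed
  have RB: "z' i \<in> rational_blocks sc e" for i
    using z'(1) by (simp add: bbd_def)
  have "finite (\<Union>x\<in>set t. supp sc e x)"
    using rational_blocksD(3)[OF e RB] by (auto simp: t_def)
  then obtain c0 where c0: "(\<Union>x\<in>set t. supp sc e x) \<subseteq> {..<c0}"
    using finite_nat_iff_bounded by blast
  have low: "b \<le> i" if x: "x \<in> set t" and i: "i \<in> supp sc e x" for x i
  proof -
    obtain k where k: "length s \<le> k" "x = z' k"
      using x by (auto simp: t_def)
    have w_eq: "z' (length s) = w"
      using z'_s[of "length s"] by simp
    show ?thesis
    proof (cases "k = length s")
      case True
      then show ?thesis
        using k i w(2) w_eq by simp
    next
      case False
      then have "Max (supp sc e (z' (length s))) < Min (supp sc e (z' k))"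
        using k by (intro bbd_sorted[OF e z'(1)]) auto
      then show ?thesis
        using Min_le[OF rational_blocksD(3)[OF e RB], of i k] i k(2) w(2) w_eq by simp
    qed
  qed
  have "sorted_wrt (\<lambda>x y. Max (supp sc e x) < Min (supp sc e y)) t"
    unfolding t_def by (intro sorted_wrt_map_upt bbd_sorted[OF e z'(1)])
  moreover have "x \<in> rational_blocks sc e" if "x \<in> set t" for x
    using that RB by (auto simp: t_def)
  moreover have "supp sc e x \<subseteq> {b..<max b c0}" if "x \<in> set t" for x
    using low[OF that] c0 that by fastforce
  ultimately have "block_string e b (max b c0) t"
    by (simp add: block_string_def)
  moreover have "string_avoids e N (s @ t)"
    unfolding st string_avoids_def using avoid by simp
  ultimately show thesis
    using that[of "max b c0" t] by simp
qed

text \<open>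
  Extensions that serve one requirement after the other can be chained, since avoidance persists
  when a string grows. Chaining ends after finitely many steps only for a finite set \<open>Q\<close>; the
  strings supported below \<open>b\<close> are in general infinite in number.
\<close>

lemma block_strings_avoid:
  assumes e: "uncond e K" and "finite Q"
    and "\<And>s N. (s, N) \<in> Q \<Longrightarrow> block_string e 0 b s \<and> nowhere_dense_in (bbd_topology sc e) N"
  shows "\<exists>t c. b \<le> c \<and> block_string e b c t \<and> t \<noteq> [] \<and> (\<forall>(s, N)\<in>Q. string_avoids e N (s @ t))"
  using assms(2,3)
proof (induction Q)
  case empty
  obtain w where "w \<in> rational_blocks sc e" "supp sc e w = {b}"
    by (rule rational_block_at[OF e])
  then have "block_string e b (Suc b) [w]"
    by (simp add: block_string_def)
  then show ?case
    by (intro exI[of _ "[w]"] exI[of _ "Suc b"]) simp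
next
  case (insert q Q)
  obtain s N where q: "q = (s, N)"
    by (cases q)
  obtain t c where t: "b \<le> c" "block_string e b c t" "t \<noteq> []" "\<forall>(s, N)\<in>Q. string_avoids e N (s @ t)"
    using insert by blast
  have "block_string e 0 b s" and N: "nowhere_dense_in (bbd_topology sc e) N"
    using insert.prems q by blast+
  then have "block_string e 0 c (s @ t)"
    using block_string_append[OF e _ t(2)] t(1) by simp
  then obtain t' d where t': "c \<le> d" "block_string e c d t'" "string_avoids e N ((s @ t) @ t')"
    by (rule block_string_avoid[OF e N])
  have "string_avoids e M (r @ (t @ t'))" if "(r, M) \<in> insert q Q" for r M
    using that t(4) t'(3) string_avoids_append[of e M "r @ t" t'] by (auto simp: q)
  moreover have "block_string e b d (t @ t')"
    by (rule block_string_append[OF e t(2) t'(2) t(1) t'(1)])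
  ultimately show ?case
    using t(1,3) t'(1) by (intro exI[of _ "t @ t'"] exI[of _ d]) auto
qed

lemma interval_index:
  fixes n :: "nat \<Rightarrow> nat"
  assumes "strict_mono n" "n 0 = 0"
  shows "\<exists>k. i \<in> {n k..<n (Suc k)}"
proof (induction i)
  case 0
  have "n 0 < n (Suc 0)"
    using assms(1) by (simp add: strict_mono_def)
  then show ?case
    using assms(2) by (intro exI[of _ 0]) simp
next
  case (Suc i)
  then obtain k where k: "n k \<le> i" "i < n (Suc k)"
    by auto
  have "n (Suc k) < n (Suc (Suc k))"
    using assms(1) by (simp add: strict_mono_def)
  then show ?case
    using k by (cases "Suc i < n (Suc k)") (force intro: exI[of _ k] exI[of _ "Suc k"])+
qed

text \<open>
  The state of the recursion consists of the current index \<open>n k\<close> and the finite set of all strings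
  obtained so far by putting \<open>t j\<close>, the vectors \<open>y i\<close> with \<open>n j \<le> i < n (j + 1)\<close>, or nothing, in
  the \<open>j\<close>-th place for each \<open>j < k\<close>. The next string \<open>t k\<close> makes all of them avoid the first \<open>k + 1\<close>
  of the sets \<open>N j\<close> at once, and \<open>n (k + 1)\<close> is taken so large that \<open>y\<close> continues beyond \<open>t k\<close>. A
  choice of places that uses infinitely many \<open>t k\<close> then avoids every \<open>N j\<close>.
\<close>

lemma generic_pieces:
  fixes N :: "nat \<Rightarrow> (nat \<Rightarrow> 'a) set" and p :: "nat \<Rightarrow> nat"
  assumes e: "uncond e K" and y: "y \<in> bbd sc e" and p: "strict_mono p"
    and y_span: "\<And>n. y n \<in> span (e ` {p n..<p (Suc n)})"
    and N: "\<And>j. nowhere_dense_in (bbd_topology sc e) (N j)"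
  obtains n :: "nat \<Rightarrow> nat" and t :: "nat \<Rightarrow> 'a list"
  where "strict_mono n" and "n 0 = 0" and "\<forall>k. block_string e (p (n k)) (p (n (Suc k))) (t k)"
    and "\<forall>I J. infinite I \<longrightarrow> I \<inter> J = {} \<longrightarrow>
      (\<exists>z\<in>bbd sc e. (\<forall>j. z \<notin> N j) \<and>
        range z = (\<Union>k\<in>I. set (t k)) \<union> (\<Union>k\<in>J. y ` {n k..<n (Suc k)}))"
proof -
  have y_string: "block_string e (p m) (p n) (map y [m..<n])" for m n
  proof -
    have "supp sc e (y i) \<subseteq> {p m..<p n}" if "m \<le> i" "i < n" for i
    proof -
      have "{p i..<p (Suc i)} \<subseteq> {p m..<p n}"
        using that by (simp add: strict_mono_less_eq[OF p] ivl_subset)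
      then show ?thesis
        using supp_span(2)[OF e y_span[of i]] by blast
    qed
    then show ?thesis
      using y unfolding block_string_def
      by (auto simp: bbd_def intro!: sorted_wrt_map_upt bbd_sorted[OF e y])
  qed
  define good where "good k X \<longleftrightarrow> (k = 0 \<longrightarrow> fst X = 0) \<and> finite (snd X) \<and> [] \<in> snd X \<and>
    (\<forall>s\<in>snd X. block_string e 0 (p (fst X)) s)" for k :: nat and X :: "nat \<times> 'a list set"
  define step where "step k X t Y \<longleftrightarrow> fst X < fst Y \<and> t \<noteq> [] \<and>
    block_string e (p (fst X)) (p (fst Y)) t \<and>
    (\<forall>s\<in>snd X. \<forall>j\<le>k. string_avoids e (N j) (s @ t)) \<and>
    snd Y = snd X \<union> (\<lambda>s. s @ t) ` snd X \<union> (\<lambda>s. s @ map y [fst X..<fst Y]) ` snd X"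
    for k :: nat and X Y :: "nat \<times> 'a list set" and t :: "'a list"
  have "\<exists>X. \<forall>k. good k (X k) \<and> (\<exists>t. step k (X k) t (X (Suc k)))"
  proof (rule dependent_nat_choice)
    show "\<exists>X. good 0 X"
      by (intro exI[of _ "(0, {[]})"]) (simp add: good_def block_string_Nil)
    fix X k
    assume X: "good k X"
    obtain n S where nS: "X = (n, S)"
      by (cases X)
    have S: "finite S" "[] \<in> S" "\<And>s. s \<in> S \<Longrightarrow> block_string e 0 (p n) s"
      using X by (auto simp: good_def nS)
    have "\<exists>t c. p n \<le> c \<and> block_string e (p n) c t \<and> t \<noteq> [] \<and>
        (\<forall>(s, M)\<in>S \<times> N ` {..k}. string_avoids e M (s @ t))"
      using S N by (intro block_strings_avoid[OF e]) auto
    then obtain t c where t: "p n \<le> c" "block_string e (p n) c t" "t \<noteq> []"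
      "\<forall>(s, M)\<in>S \<times> N ` {..k}. string_avoids e M (s @ t)"
      by blast
    \<comment> \<open>As \<open>p\<close> is strictly increasing, \<open>p n' \<ge> n' > c\<close>.\<close>
    define n' where "n' = Suc (max n c)"
    have n': "n < n'" "p n \<le> p n'" "c \<le> p n'"
      using strict_mono_imp_increasing[OF p, of n'] by (auto simp: n'_def strict_mono_less_eq[OF p])
    have t': "block_string e (p n) (p n') t"
      using block_string_mono[OF t(2)] n'(3) by simp
    define S' where "S' = S \<union> (\<lambda>s. s @ t) ` S \<union> (\<lambda>s. s @ map y [n..<n']) ` S"
    have "block_string e 0 (p n') s" if "s \<in> S'" for s
      using that S(3) n'(2) unfolding S'_def
      by (auto intro: block_string_append[OF e _ t'] block_string_append[OF e _ y_string] block_string_mono)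
    then have "good (Suc k) (n', S')"
      using S by (simp add: good_def S'_def)
    moreover have "step k X t (n', S')"
      using n'(1) t(3,4) t' by (auto simp: step_def nS S'_def)
    ultimately show "\<exists>Y. good (Suc k) Y \<and> (\<exists>t. step k X t Y)"
      by blast
  qed
  then obtain X t where X: "\<And>k. good k (X k)" "\<And>k. step k (X k) (t k) (X (Suc k))"
    by metis
  define n where "n k = fst (X k)" for k
  have n: "strict_mono n"
    using X(2) by (simp add: strict_mono_Suc_iff n_def step_def)
  have n0: "n 0 = 0"
    using X(1)[of 0] by (simp add: good_def n_def)
  have t: "\<forall>k. block_string e (p (n k)) (p (n (Suc k))) (t k)"
    using X(2) by (simp add: n_def step_def)
  have "\<exists>z\<in>bbd sc e. (\<forall>j. z \<notin> N j) \<and>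
      range z = (\<Union>k\<in>I. set (t k)) \<union> (\<Union>k\<in>J. y ` {n k..<n (Suc k)})"
    if I: "infinite I" and IJ: "I \<inter> J = {}" for I J
  proof -
    define seg where "seg k = (if k \<in> I then t k else if k \<in> J then map y [n k..<n (Suc k)] else [])" for k
    define P where "P k = concat (map seg [0..<k])" for k
    have P_Suc: "P (Suc k) = P k @ seg k" for k
      by (simp add: P_def)
    have P_in: "P k \<in> snd (X k)" for k
    proof (induction k)
      case 0
      then show ?case
        using X(1)[of 0] by (simp add: P_def good_def)
    next
      case (Suc k)
      then show ?case
        using X(2)[of k] by (auto simp: P_Suc seg_def step_def n_def)
    qed
    have len_mono: "length (P k) \<le> length (P l)" if "k \<le> l" for k l
      using that by (induction l rule: dec_induct) (auto simp: P_Suc)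
    have "\<exists>k. m < length (P k)" for m
    proof (induction m)
      case 0
      obtain k where "k \<in> I"
        using I by fastforce
      then have "0 < length (P (Suc k))"
        using X(2)[of k] by (simp add: P_Suc seg_def step_def)
      then show ?case ..
    next
      case (Suc m)
      then obtain k where k: "m < length (P k)"
        by blast
      obtain l where l: "l > k" "l \<in> I"
        using I unfolding infinite_nat_iff_unbounded by blast
      have "length (P l) < length (P (Suc l))"
        using X(2)[of l] l(2) by (simp add: P_Suc seg_def step_def)
      then have "Suc m < length (P (Suc l))"
        using k len_mono[of k l] l(1) by simp
      then show ?case ..
    qed
    moreover have "\<exists>b. block_string e 0 b (P k)" for k
      using P_in X(1) by (auto simp: good_def)
    moreover have "\<exists>t. P (Suc k) = P k @ t" for k
      by (simp add: P_Suc)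
    ultimately obtain z where z: "z \<in> bbd sc e" "\<forall>k. \<forall>i<length (P k). z i = P k ! i" "range z = (\<Union>k. set (P k))"
      using block_string_limit[OF e, of P] by metis
    have "z \<notin> N j" for j
    proof -
      obtain k where k: "k > j" "k \<in> I"
        using I unfolding infinite_nat_iff_unbounded by blast
      have "string_avoids e (N j) (P k @ t k)"
        using X(2)[of k] P_in[of k] k(1) by (simp add: step_def)
      then have "string_avoids e (N j) (P (Suc k))"
        using k(2) by (simp add: P_Suc seg_def)
      then show ?thesis
        using z(1,2) by (simp add: string_avoids_def)
    qed
    moreover have "(\<Union>k. set (P k)) = (\<Union>k. set (seg k))"
      by (fastforce simp: P_def)
    moreover have "(\<Union>k. set (seg k)) = (\<Union>k\<in>I. set (t k)) \<union> (\<Union>k\<in>J. y ` {n k..<n (Suc k)})"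
    proof
      show "(\<Union>k. set (seg k)) \<subseteq> (\<Union>k\<in>I. set (t k)) \<union> (\<Union>k\<in>J. y ` {n k..<n (Suc k)})"
        by (auto simp: seg_def split: if_splits)
      have "set (seg k) = set (t k)" if "k \<in> I" for k
        using that by (simp add: seg_def)
      moreover have "set (seg k) = y ` {n k..<n (Suc k)}" if "k \<in> J" for k
        using that IJ by (auto simp: seg_def)
      ultimately show "(\<Union>k\<in>I. set (t k)) \<union> (\<Union>k\<in>J. y ` {n k..<n (Suc k)}) \<subseteq> (\<Union>k. set (seg k))"
        by blast
    qed
    ultimately show ?thesis
      using z(1,3) by auto
  qed
  then show thesis
    by (intro that[OF n n0 t] allI impI)
qed


section \<open>The residual class absorbs block-subspaces\<close>

text \<open>
  With \<open>T I\<close> the generic strings at places \<open>I\<close> and \<open>W J\<close> the vectors of \<open>w\<close> at places \<open>J\<close>, both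
  \<open>T I\<close> and \<open>T I \<union> W J\<close> span copies of \<open>A\<close> whenever \<open>I\<close> is infinite and disjoint from \<open>J\<close>. So \<open>A\<close>
  absorbs the span of \<open>W J\<close>; the even and the odd places together give all of \<open>w\<close>.
\<close>

lemma residual_class_absorbs:
  assumes e: "uncond e K" and x: "in_residual_class sc e x" and y: "block_sequence sc e y"
  shows "lin_isomorphic sc (cspan (range x)) (module_prod.scale sc sc) (cspan (range x) \<times> cspan (range y))"
proof -
  let ?A = "cspan (range x)" and ?P = "module_prod.scale sc sc"
  obtain w where w: "w \<in> bbd sc e" and yw: "lin_isomorphic sc (cspan (range y)) sc (cspan (range w))"
    by (rule bbd_lin_isomorphic[OF e y])
  then have "blocks e w"
    by (simp add: bbd_def block_sequence_iff[OF e])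
  then obtain p :: "nat \<Rightarrow> nat" where p: "strict_mono p" and "\<forall>n. w n \<in> span (e ` {p n..<p (Suc n)})"
    by (rule blocksE)
  then have w_span: "w n \<in> span (e ` {p n..<p (Suc n)})" for n
    by blast
  let ?C = "{z \<in> bbd sc e. lin_isomorphic sc (closed_span sc z) sc (closed_span sc x)}"
  have "meagre_in (bbd_topology sc e) (bbd sc e - ?C)"
    using x by (simp add: in_residual_class_def comeagre_in_def topspace_bbd_topology)
  then obtain N :: "nat \<Rightarrow> (nat \<Rightarrow> 'a) set" where N: "\<And>j. nowhere_dense_in (bbd_topology sc e) (N j)"
    "bbd sc e - ?C = (\<Union>j. N j)"
    unfolding meagre_in_def by blast
  obtain n t where n: "strict_mono n" "n 0 = 0"
    and t: "\<forall>k. block_string e (p (n k)) (p (n (Suc k))) (t k)"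
    and generic: "\<forall>I J. infinite I \<longrightarrow> I \<inter> J = {} \<longrightarrow>
      (\<exists>z\<in>bbd sc e. (\<forall>j. z \<notin> N j) \<and>
        range z = (\<Union>k\<in>I. set (t k)) \<union> (\<Union>k\<in>J. w ` {n k..<n (Suc k)}))"
    by (rule generic_pieces[OF e w p w_span N(1)])
  define T where "T I = (\<Union>k\<in>I. set (t k))" for I
  define W where "W J = (\<Union>k\<in>J. w ` {n k..<n (Suc k)})" for J
  have in_class: "\<exists>z\<in>bbd sc e. range z = T I \<union> W J \<and> lin_isomorphic sc (cspan (range z)) sc ?A"
    if IJ: "infinite I" "I \<inter> J = {}" for I J
  proof -
    obtain z where z: "z \<in> bbd sc e" "\<forall>j. z \<notin> N j" "range z = T I \<union> W J"
      using generic[rule_format, OF IJ] unfolding T_def W_def by blast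
    then have "z \<in> ?C"
      using N(2) by blast
    then show ?thesis
      using z(1,3) unfolding closed_span_eq by blast
  qed
  have pn: "strict_mono (p \<circ> n)"
    using p n(1) by (rule strict_mono_o)
  have T_piece: "v \<in> rational_blocks sc e" "supp sc e v \<subseteq> {p (n k)..<p (n (Suc k))}" if "v \<in> set (t k)" for v k
    using t that by (auto simp: block_string_def)
  have W_piece: "v \<in> rational_blocks sc e" "supp sc e v \<subseteq> {p (n k)..<p (n (Suc k))}"
    if v: "v \<in> w ` {n k..<n (Suc k)}" for v k
  proof -
    obtain i where i: "v = w i" "n k \<le> i" "i < n (Suc k)"
      using v by auto
    have "{p i..<p (Suc i)} \<subseteq> {p (n k)..<p (n (Suc k))}"
      using i by (simp add: strict_mono_less_eq[OF p] ivl_subset)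
    then show "v \<in> rational_blocks sc e" "supp sc e v \<subseteq> {p (n k)..<p (n (Suc k))}"
      using supp_span(2)[OF e w_span[of i]] w by (auto simp: i(1) bbd_def)
  qed
  have same: "k = l" if v: "v \<in> rational_blocks sc e"
    and kl: "supp sc e v \<subseteq> {p (n k)..<p (n (Suc k))}" "supp sc e v \<subseteq> {p (n l)..<p (n (Suc l))}" for v k l
  proof -
    obtain i where i: "i \<in> supp sc e v"
      using rational_blocksD(4)[OF e v] by blast
    show ?thesis
      using strict_mono_intervals_disjoint[OF pn, of i k l] subsetD[OF kl(1) i] subsetD[OF kl(2) i] by simp
  qed
  have TW: "T I \<inter> W J = {}" if "I \<inter> J = {}" for I J
  proof (rule equals0I)
    fix v
    assume "v \<in> T I \<inter> W J"
    then obtain k l where kl: "k \<in> I" "v \<in> set (t k)" "l \<in> J" "v \<in> w ` {n l..<n (Suc l)}"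
      unfolding T_def W_def by blast
    from same[OF T_piece[OF kl(2)] W_piece(2)[OF kl(4)]] show False
      using kl(1,3) that by blast
  qed
  have WW: "W I \<inter> W J = {}" if "I \<inter> J = {}" for I J
  proof (rule equals0I)
    fix v
    assume "v \<in> W I \<inter> W J"
    then obtain k l where kl: "k \<in> I" "v \<in> w ` {n k..<n (Suc k)}" "l \<in> J" "v \<in> w ` {n l..<n (Suc l)}"
      unfolding W_def by blast
    from same[OF W_piece[OF kl(2)] W_piece(2)[OF kl(4)]] show False
      using kl(1,3) that by blast
  qed
  have absorb: "lin_isomorphic sc ?A ?P (?A \<times> cspan (W J))" if IJ: "infinite I" "I \<inter> J = {}" for I J
  proof -
    have "\<exists>z\<in>bbd sc e. range z = T I \<union> W {} \<and> lin_isomorphic sc (cspan (range z)) sc ?A"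
      using IJ(1) by (intro in_class) auto
    then have TI: "lin_isomorphic sc (cspan (T I)) sc ?A"
      by (auto simp: W_def)
    obtain z where z: "z \<in> bbd sc e" "range z = T I \<union> W J" "lin_isomorphic sc (cspan (range z)) sc ?A"
      using in_class[OF IJ] by blast
    have "lin_isomorphic ?P (cspan (T I) \<times> cspan (W J)) sc (cspan (range z))"
      using bbd_uncond[OF e z(1)] TW[OF IJ(2)] z(2) by (intro uncond_split_lin_isomorphic) auto
    then have "lin_isomorphic sc (cspan (range z)) ?P (cspan (T I) \<times> cspan (W J))"
      by (rule lin_isomorphic_sym)
        (auto simp: module_prod_scale[OF module_axioms module_axioms] cspan_add cspan_scale)
    with lin_isomorphic_cspan_sym[OF z(3)] have "lin_isomorphic sc ?A ?P (cspan (T I) \<times> cspan (W J))"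
      by (rule lin_isomorphic_trans)
    moreover have "lin_isomorphic ?P (cspan (T I) \<times> cspan (W J)) ?P (?A \<times> cspan (W J))"
      by (intro lin_isomorphic_Times module_axioms TI lin_isomorphic_refl)
    ultimately show ?thesis
      by (rule lin_isomorphic_trans)
  qed
  let ?E = "Collect even :: nat set" and ?O = "Collect odd :: nat set"
  have inf: "infinite ?E" "infinite ?O"
  proof -
    have "\<exists>k>m. even k" "\<exists>k>m. odd k" for m :: nat
      by (rule exI[of _ "2 * Suc m"], simp) (rule exI[of _ "Suc (2 * m)"], simp)
    then show "infinite ?E" "infinite ?O"
      by (simp_all add: infinite_nat_iff_unbounded)
  qed
  have EO: "?E \<inter> ?O = {}" "?O \<inter> ?E = {}"
    by auto
  have "W ?E \<union> W ?O = range w"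
  proof
    show "range w \<subseteq> W ?E \<union> W ?O"
    proof (rule image_subsetI)
      fix i
      obtain k where "i \<in> {n k..<n (Suc k)}"
        using interval_index[OF n] by blast
      then show "w i \<in> W ?E \<union> W ?O"
        unfolding W_def by blast
    qed
  qed (auto simp: W_def)
  then have W: "lin_isomorphic ?P (cspan (W ?E) \<times> cspan (W ?O)) sc (cspan (range w))"
    using WW[OF EO(1)] by (intro uncond_split_lin_isomorphic[OF bbd_uncond[OF e w]]) auto
  note mods = module_axioms banach_over_prod[OF banach_over_axioms banach_over_axioms]
  have "lin_isomorphic sc ?A ?P (?A \<times> cspan (W ?O))"
    by (rule absorb[OF inf(1) EO(1)])
  moreover have "lin_isomorphic ?P (?A \<times> cspan (W ?O)) (module_prod.scale ?P sc) ((?A \<times> cspan (W ?E)) \<times> cspan (W ?O))"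
    by (intro lin_isomorphic_Times mods absorb[OF inf(2) EO(2)] lin_isomorphic_refl)
  moreover have "lin_isomorphic (module_prod.scale ?P sc) ((?A \<times> cspan (W ?E)) \<times> cspan (W ?O))
      (module_prod.scale sc ?P) (?A \<times> (cspan (W ?E) \<times> cspan (W ?O)))"
    by (intro lin_isomorphic_Times_assoc banach_over_axioms)
  moreover have "lin_isomorphic (module_prod.scale sc ?P) (?A \<times> (cspan (W ?E) \<times> cspan (W ?O)))
      ?P (?A \<times> cspan (range y))"
    by (intro lin_isomorphic_Times mods lin_isomorphic_refl
        lin_isomorphic_trans[OF W lin_isomorphic_cspan_sym[OF yw]])
  ultimately show ?thesis
    by (blast intro: lin_isomorphic_trans)
qed


section \<open>Embeddings between block-subspaces\<close>

lemma continuous_homogeneous_bounded: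
  fixes h :: "'a \<Rightarrow> 'a"
  assumes "continuous_on S h" and "0 \<in> S" and scale: "\<And>r x. x \<in> S \<Longrightarrow> r *\<^sub>R x \<in> S"
    and hom: "\<And>r x. x \<in> S \<Longrightarrow> h (r *\<^sub>R x) = r *\<^sub>R h x"
  shows "\<exists>M>0. \<forall>x\<in>S. norm (h x) \<le> M * norm x"
proof -
  have h0: "h 0 = 0"
    using hom[OF assms(2), of 0] by simp
  obtain d where d: "0 < d" "\<And>x. x \<in> S \<Longrightarrow> norm x < d \<Longrightarrow> norm (h x) < 1"
    using assms(1,2) h0 unfolding continuous_on_iff by (metis dist_0_norm dist_commute zero_less_one)
  have "norm (h x) \<le> (2 / d) * norm x" if "x \<in> S" for x
  proof (cases "x = 0")
    case False
    let ?r = "d / (2 * norm x)"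
    have r: "0 < ?r"
      using d(1) False by simp
    have "norm (h (?r *\<^sub>R x)) < 1"
      using d(1) False by (intro d(2) scale that) simp
    then have "?r * norm (h x) < 1"
      using d(1) by (simp add: hom[OF that])
    then show ?thesis
      using d(1) False by (simp add: field_simps)
  qed (simp add: h0)
  moreover have "0 < 2 / d"
    using d(1) by simp
  ultimately show ?thesis
    by blast
qed

text \<open>
  A linear homeomorphism and its inverse are continuous at \<open>0\<close>, so both are bounded.
\<close>

lemma lin_isomorphic_linear_embedding:
  assumes "lin_isomorphic sc (cspan A) sc (T :: 'a set)"
  obtains f where "linear_embedding sc (cspan A) sc f" and "f ` cspan A = T"
proof -
  let ?S = "cspan A"
  obtain f g where fg: "homeomorphism ?S T f g"
    and add: "\<And>x y. x \<in> ?S \<Longrightarrow> y \<in> ?S \<Longrightarrow> f (x + y) = f x + f y"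
    and f_sc: "\<And>c x. x \<in> ?S \<Longrightarrow> f (sc c x) = sc c (f x)"
    using assms unfolding lin_isomorphic_def by blast
  have img: "f ` ?S = T" and gf: "\<And>x. x \<in> ?S \<Longrightarrow> g (f x) = x"
    using fg by (auto simp: homeomorphism_def)
  have scS: "r *\<^sub>R x \<in> ?S" if "x \<in> ?S" for r x
    using cspan_scale[OF that, of "r *\<^sub>R 1"] by (simp only: scale_real)
  have hom: "f (r *\<^sub>R x) = r *\<^sub>R f x" if "x \<in> ?S" for r x
    using f_sc[OF that, of "r *\<^sub>R 1"] by (simp only: scale_real)
  have f0: "f 0 = 0"
    using hom[OF cspan_zero, of 0] by simp
  obtain M where M: "\<And>x. x \<in> ?S \<Longrightarrow> norm (f x) \<le> M * norm x"
    using continuous_homogeneous_bounded[OF homeomorphism_cont1[OF fg] cspan_zero scS hom] by blast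
  have "0 \<in> T"
    using img f0 cspan_zero by (metis image_eqI)
  moreover have "r *\<^sub>R y \<in> T" if "y \<in> T" for r y
    using that scS hom by (auto simp: img[symmetric] image_iff intro!: bexI[of _ "r *\<^sub>R _"])
  moreover have "g (r *\<^sub>R y) = r *\<^sub>R g y" if "y \<in> T" for r y
    using that gf scS by (auto simp: img[symmetric] hom[symmetric])
  ultimately have "\<exists>L>0. \<forall>y\<in>T. norm (g y) \<le> L * norm y"
    by (rule continuous_homogeneous_bounded[OF homeomorphism_cont2[OF fg]])
  then obtain L where L: "0 < L" "\<And>y. y \<in> T \<Longrightarrow> norm (g y) \<le> L * norm y"
    by blast
  have "1 / L * norm x \<le> norm (f x)" if "x \<in> ?S" for x
    using L(2)[of "f x"] gf[OF that] img that L(1) by (auto simp: field_simps)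
  then have "\<exists>m>0. \<forall>x\<in>?S. m * norm x \<le> norm (f x)"
    using L(1) by (intro exI[of _ "1 / L"]) simp
  then have "linear_embedding sc ?S sc f"
    using add f_sc M unfolding linear_embedding_def by blast
  then show thesis
    using that img by blast
qed

text \<open>
  Finitely many coordinates of \<open>T x\<close> are killed one at a time, each by combining two vectors with
  disjoint supports; the combination is nonzero by unconditionality of \<open>c\<close>.
\<close>

lemma exists_block_killing_coords:
  assumes y: "uncond y K" and c: "uncond c K'" and T: "linear_embedding sc (cspan (range c)) sc T"
    and TS: "T ` cspan (range c) \<subseteq> cspan (range y)"
  shows "\<exists>M>m. \<exists>x\<in>span (c ` {m..<M}). x \<noteq> 0 \<and> (\<forall>i<N. coords sc y (T x) i = 0)"
proof (induction N arbitrary: m)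
  case 0
  then show ?case
    using uncond_nonzero[OF c, of m] by (intro exI[of _ "Suc m"] conjI bexI[of _ "c m"]) (auto intro: span_base)
next
  case (Suc N)
  obtain M1 x1 where x1: "m < M1" "x1 \<in> span (c ` {m..<M1})" "x1 \<noteq> 0" "\<forall>i<N. coords sc y (T x1) i = 0"
    using Suc.IH by blast
  obtain M2 x2 where x2: "M1 < M2" "x2 \<in> span (c ` {M1..<M2})" "x2 \<noteq> 0" "\<forall>i<N. coords sc y (T x2) i = 0"
    using Suc.IH by blast
  have in_c: "x1 \<in> cspan (range c)" "x2 \<in> cspan (range c)"
    using x1(2) x2(2) span_mono[of "c ` _" "range c"] span_subset_cspan by blast+
  then have in_y: "T x1 \<in> cspan (range y)" "T x2 \<in> cspan (range y)"
    using TS by blast+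
  let ?a = "coords sc y (T x1) N" and ?b = "coords sc y (T x2) N"
  show ?case
  proof (cases "?a = 0")
    case True
    then show ?thesis
      using x1 by (intro exI[of _ M1] conjI bexI[of _ x1]) (auto simp: less_Suc_eq)
  next
    case False
    define r where "r = - ?b / ?a"
    let ?x = "x2 + sc r x1"
    have "T ?x = T x2 + T (sc r x1)"
      using T in_c cspan_scale unfolding linear_embedding_def by blast
    also have "T (sc r x1) = sc r (T x1)"
      using T in_c unfolding linear_embedding_def by blast
    finally have "coords sc y (T ?x) i = coords sc y (T x2) i + r * coords sc y (T x1) i" for i
      using in_y by (simp add: coords_add[OF y] coords_scale[OF y] cspan_scale)
    then have "coords sc y (T ?x) i = 0" if "i < Suc N" for i
      using that x1(4) x2(4) False by (cases "i = N") (auto simp: r_def)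
    moreover have "?x \<noteq> 0"
    proof
      assume "?x = 0"
      moreover have "norm x2 \<le> K' * norm ?x"
        by (rule uncond_norm_le[OF c _ x2(2) span_scale[OF x1(2)]]) auto
      ultimately show False
        using x2(3) by simp
    qed
    moreover have "?x \<in> span (c ` {m..<M2})"
      using x1(1,2) x2(1,2) span_mono[of "c ` {m..<M1}" "c ` {m..<M2}"] span_mono[of "c ` {M1..<M2}" "c ` {m..<M2}"]
      by (intro span_add span_scale) (auto simp: image_mono)
    moreover have "m < M2"
      using x1(1) x2(1) by simp
    ultimately show ?thesis
      by blast
  qed
qed

text \<open>
  Gliding hump: images under \<open>T\<close> of suitable blocks of \<open>c\<close> start arbitrarily far along \<open>y\<close>, and
  cutting off their tails is a small perturbation.
\<close>

lemma embedding_of_blocks_onto_blocks: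
  assumes y: "uncond y K" and c: "uncond c K'" and T: "linear_embedding sc (cspan (range c)) sc T"
    and TS: "T ` cspan (range c) \<subseteq> cspan (range y)"
  obtains d f where "blocks c d" and "linear_embedding sc (cspan (range d)) sc f" and "blocks y (\<lambda>n. f (d n))"
proof -
  obtain \<mu> where \<mu>: "0 < \<mu>" "\<And>x. x \<in> cspan (range c) \<Longrightarrow> \<mu> * norm x \<le> norm (T x)"
    using T unfolding linear_embedding_def by blast
  have K': "1 \<le> K'"
    by (rule uncond_ge_1[OF c])
  define step where "step k X x w Y \<longleftrightarrow> fst X < fst Y \<and> snd X < snd Y \<and>
      x \<in> span (c ` {fst X..<fst Y}) \<and> x \<noteq> 0 \<and> w \<in> span (y ` {snd X..<snd Y}) \<and> w \<noteq> 0 \<and>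
      norm (w - T x) \<le> \<mu> / (4 * K') * norm x * (1 / 2) ^ k"
    for k :: nat and X Y :: "nat \<times> nat" and x w
  have "\<exists>X. \<forall>k. True \<and> (\<exists>x w. step k (X k) x w (X (Suc k)))"
  proof (rule dependent_nat_choice)
    fix X :: "nat \<times> nat" and k :: nat
    obtain m N where X: "X = (m, N)"
      by (cases X)
    obtain M x where x: "m < M" "x \<in> span (c ` {m..<M})" "x \<noteq> 0" "\<forall>i<N. coords sc y (T x) i = 0"
      using exists_block_killing_coords[OF y c T TS, of m N] by blast
    have x_c: "x \<in> cspan (range c)"
      using x(2) span_mono[of "c ` _" "range c"] span_subset_cspan by blast
    then have Tx: "T x \<in> cspan (range y)"
      using TS by blast
    let ?\<epsilon> = "\<mu> / (4 * K') * norm x * (1 / 2) ^ k"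
    have \<epsilon>: "0 < ?\<epsilon>"
      using \<mu>(1) K' x(3) by simp
    define s where "s n = (\<Sum>i<n. sc (coords sc y (T x) i) (y i))" for n
    have "s \<longlonglongrightarrow> T x"
      using coords_sums[OF y Tx] by (simp add: sums_def s_def[abs_def])
    then obtain L where L: "\<And>n. n \<ge> L \<Longrightarrow> norm (s n - T x) < ?\<epsilon>"
      using LIMSEQ_D[OF _ \<epsilon>] by blast
    define N' where "N' = max L (Suc N)"
    have "s N' = (\<Sum>i\<in>{N..<N'}. sc (coords sc y (T x) i) (y i))"
      unfolding s_def using x(4) by (intro sum.mono_neutral_right) (auto simp: N'_def not_le)
    then have w_span: "s N' \<in> span (y ` {N..<N'})"
      by (simp add: sum_in_span)
    have w_near: "norm (s N' - T x) < ?\<epsilon>"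
      by (rule L) (simp add: N'_def)
    have "s N' \<noteq> 0"
    proof
      assume "s N' = 0"
      then have "\<mu> * norm x < ?\<epsilon>"
        using w_near \<mu>(2)[OF x_c] by simp
      also have "?\<epsilon> \<le> \<mu> * norm x * 1"
      proof -
        have "\<mu> / (4 * K') \<le> \<mu>"
          using \<mu>(1) K' by (simp add: field_simps)
        then show ?thesis
          using \<mu>(1) by (intro mult_mono power_le_one) auto
      qed
      finally show False
        by simp
    qed
    then have "step k X x (s N') (M, N')"
      using x w_span w_near by (simp add: step_def X N'_def)
    then show "\<exists>Y. True \<and> (\<exists>x w. step k X x w Y)"
      by blast
  qed simp
  then obtain X d w where X: "\<And>k. step k (X k) (d k) (w k) (X (Suc k))"
    by metis
  have d: "blocks c d"
    unfolding blocks_def using X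
    by (intro exI[of _ "\<lambda>k. fst (X k)"]) (auto simp: strict_mono_Suc_iff step_def)
  have w: "blocks y w"
    unfolding blocks_def using X
    by (intro exI[of _ "\<lambda>k. snd (X k)"]) (auto simp: strict_mono_Suc_iff step_def)
  have sub: "cspan (range d) \<subseteq> cspan (range c)"
    by (rule cspan_subset[OF blocks_range_subset[OF d]])
  obtain f where f: "linear_embedding sc (cspan (range d)) sc f" "\<forall>i. f (d i) = w i"
  proof (rule perturb_embedding[OF blocks_uncond[OF c d] linear_embedding_subset[OF T sub] \<mu>(1)])
    show "\<mu> * norm x \<le> norm (T x)" if "x \<in> cspan (range d)" for x
      using \<mu>(2) sub that by blast
    show "norm (w i - T (d i)) \<le> \<mu> / (4 * K') * norm (d i) * (1 / 2) ^ i" for i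
      using X[of i] by (simp add: step_def)
  qed
  then show thesis
    using that[OF d f(1)] w by simp
qed

lemma linear_embedding_blocks:
  assumes f: "linear_embedding sc (cspan (range d)) sc f" and z: "blocks d z"
  shows "blocks (\<lambda>n. f (d n)) (\<lambda>n. f (z n))"
proof -
  obtain q :: "nat \<Rightarrow> nat" where "strict_mono q" "\<forall>n. z n \<in> span (d ` {q n..<q (Suc n)})" "\<forall>n. z n \<noteq> 0"
    by (rule blocksE[OF z])
  note q = this(1) this(2,3)[rule_format]
  have "f (z n) \<in> span ((\<lambda>n. f (d n)) ` {q n..<q (Suc n)})" for n
  proof -
    have "f ` span (d ` {q n..<q (Suc n)}) = span (f ` d ` {q n..<q (Suc n)})"
      using cspan_superset[of "range d"] by (intro linear_embedding_span_image[OF f]) auto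
    then show ?thesis
      using q(2)[of n] by (auto simp: image_image)
  qed
  moreover have "f (z n) \<noteq> 0" for n
  proof -
    obtain m where m: "0 < m" "\<And>x. x \<in> cspan (range d) \<Longrightarrow> m * norm x \<le> norm (f x)"
      using f unfolding linear_embedding_def by blast
    have "z n \<in> cspan (range d)"
      using blocks_range_subset[OF z] span_subset_cspan by blast
    then have "m * norm (z n) \<le> norm (f (z n))"
      by (rule m(2))
    moreover have "0 < m * norm (z n)"
      using m(1) q(3)[of n] by simp
    ultimately show ?thesis
      by auto
  qed
  ultimately show ?thesis
    using q(1) unfolding blocks_def by blast
qed


section \<open>Hereditary block-minimality\<close>

text \<open>
  By minimality of the whole space and of \<open>c\<close>, it is enough to embed some block-subspace of \<open>c\<close>
  into \<open>y\<close> so that blocks go to blocks.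
\<close>

lemma hereditarily_block_minimal_embeds:
  assumes e: "uncond e K" and hbm: "hereditarily_block_minimal sc e"
    and y: "block_sequence sc e y" and c: "block_sequence sc e c"
  obtains d where "block_sequence sc y d" and "lin_isomorphic sc (cspan (range c)) sc (cspan (range d))"
proof -
  have y_blocks: "blocks e y" "\<forall>n. norm (y n) = 1" and c_blocks: "blocks e c"
    using y c by (simp_all add: block_sequence_iff[OF e])
  have uy: "uncond y K" and uc: "uncond c K"
    by (rule blocks_uncond[OF e y_blocks(1)] blocks_uncond[OF e c_blocks])+
  \<comment> \<open>The basis need not be normalized, so minimality is applied to its normalization.\<close>
  obtain e' where e': "block_sequence sc e e'" "cspan (range e') = cspan (range e)"
    and e'_blocks: "\<And>z. blocks e' z \<longleftrightarrow> blocks e z"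
    by (rule blocks_normalize[OF e blocks_refl[OF e]]) blast
  have ue': "uncond e' K"
    using blocks_uncond[OF e] e'(1) by (simp add: block_sequence_iff[OF e])
  have "block_sequence sc e' y"
    using y_blocks e'_blocks by (simp add: block_sequence_iff[OF ue'])
  moreover have "block_minimal sc e'"
    using hbm e'(1) by (simp add: hereditarily_block_minimal_def)
  ultimately obtain z where z: "block_sequence sc y z" "lin_isomorphic sc (cspan (range z)) sc (cspan (range e))"
    unfolding block_minimal_def closed_span_eq e'(2) by blast
  obtain T where T: "linear_embedding sc (cspan (range e)) sc T" "T ` cspan (range e) = cspan (range z)"
    by (rule lin_isomorphic_linear_embedding[OF lin_isomorphic_cspan_sym[OF z(2)]])
  have sub: "cspan (range c) \<subseteq> cspan (range e)" "cspan (range z) \<subseteq> cspan (range y)"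
    using z(1) c_blocks by (auto intro!: cspan_subset blocks_range_subset simp: block_sequence_iff[OF uy])
  have Tc: "T ` cspan (range c) \<subseteq> cspan (range y)"
    using image_mono[OF sub(1), of T] T(2) sub(2) by simp
  obtain b f where b: "blocks c b" and f: "linear_embedding sc (cspan (range b)) sc f"
    and fb: "blocks y (\<lambda>n. f (b n))"
    by (rule embedding_of_blocks_onto_blocks[OF uy uc linear_embedding_subset[OF T(1) sub(1)] Tc])
  obtain b' where b': "block_sequence sc c b'" "\<And>z. blocks b' z \<longleftrightarrow> blocks b z"
    by (rule blocks_normalize[OF uc b]) blast
  have ub': "uncond b' K"
    using blocks_uncond[OF uc] b'(1) by (simp add: block_sequence_iff[OF uc])
  have "block_minimal sc c"
    using hbm c by (simp add: hereditarily_block_minimal_def)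
  then obtain a where a: "block_sequence sc b' a" "lin_isomorphic sc (cspan (range a)) sc (cspan (range c))"
    using b'(1) unfolding block_minimal_def closed_span_eq by blast
  then have ba: "blocks b a"
    using b'(2) by (simp add: block_sequence_iff[OF ub'])
  have "blocks y (\<lambda>n. f (a n))"
    by (rule blocks_trans[OF fb linear_embedding_blocks[OF f ba]])
  then obtain d where d: "block_sequence sc y d" "cspan (range d) = cspan (range (\<lambda>n. f (a n)))"
    by (rule blocks_normalize[OF uy]) blast
  have "linear_embedding sc (cspan (range a)) sc f"
    by (rule linear_embedding_subset[OF f cspan_subset[OF blocks_range_subset[OF ba]]])
  then have "lin_isomorphic sc (cspan (range a)) sc (cspan (range d))"
    unfolding d(2) by (metis linear_embedding_cspan_lin_isomorphic image_image)
  then have "lin_isomorphic sc (cspan (range c)) sc (cspan (range d))"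
    by (rule lin_isomorphic_trans[OF lin_isomorphic_cspan_sym[OF a(2)]])
  then show thesis
    using that d(1) by blast
qed

lemma residual_class_block_sequence:
  assumes e: "uncond e K" and y: "block_sequence sc e y" and u: "in_residual_class sc y u"
  shows "block_sequence sc e u" and "uncond y K"
proof -
  show uy: "uncond y K"
    using blocks_uncond[OF e] y by (simp add: block_sequence_iff[OF e])
  have "block_sequence sc y u"
    using u by (simp add: in_residual_class_def bbd_def)
  then show "block_sequence sc e u"
    using blocks_trans y by (auto simp: block_sequence_iff[OF e] block_sequence_iff[OF uy])
qed

text \<open>
  Each residual class contains the other as a block-subspace, up to isomorphism, and hence absorbs
  it; both are therefore isomorphic to their direct sum.
\<close>

lemma residual_classes_isomorphic:
  assumes e: "uncond e K" and hbm: "hereditarily_block_minimal sc e"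
    and y: "block_sequence sc e y" and z: "block_sequence sc e z"
    and u: "in_residual_class sc y u" and v: "in_residual_class sc z v"
  shows "lin_isomorphic sc (cspan (range u)) sc (cspan (range v))"
proof -
  let ?P = "module_prod.scale sc sc"
  have absorb: "lin_isomorphic sc (cspan (range u)) ?P (cspan (range u) \<times> cspan (range v))"
    if y: "block_sequence sc e y" and u: "in_residual_class sc y u" and v: "block_sequence sc e v" for y u v
  proof -
    obtain d where d: "block_sequence sc y d" "lin_isomorphic sc (cspan (range v)) sc (cspan (range d))"
      by (rule hereditarily_block_minimal_embeds[OF e hbm y v])
    have "lin_isomorphic sc (cspan (range u)) ?P (cspan (range u) \<times> cspan (range d))"
      by (rule residual_class_absorbs[OF residual_class_block_sequence(2)[OF e y u] u d(1)])
    moreover have "lin_isomorphic ?P (cspan (range u) \<times> cspan (range d)) ?P (cspan (range u) \<times> cspan (range v))"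
      by (intro lin_isomorphic_Times module_axioms lin_isomorphic_refl lin_isomorphic_cspan_sym[OF d(2)])
    ultimately show ?thesis
      by (rule lin_isomorphic_trans)
  qed
  have uv: "lin_isomorphic sc (cspan (range u)) ?P (cspan (range u) \<times> cspan (range v))"
    by (rule absorb[OF y u residual_class_block_sequence(1)[OF e z v]])
  have vu: "lin_isomorphic sc (cspan (range v)) ?P (cspan (range v) \<times> cspan (range u))"
    by (rule absorb[OF z v residual_class_block_sequence(1)[OF e y u]])
  have "lin_isomorphic ?P (cspan (range u) \<times> cspan (range v)) ?P (cspan (range v) \<times> cspan (range u))"
    by (intro lin_isomorphic_swap banach_over_axioms)
  from lin_isomorphic_trans[OF lin_isomorphic_trans[OF uv this] lin_isomorphic_cspan_sym[OF vu]]
  show ?thesis .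
qed

end

theorem corollary10:
  fixes sc :: "'k::real_or_complex \<Rightarrow> 'a::banach \<Rightarrow> 'a"
    and e :: "nat \<Rightarrow> 'a"
  assumes "banach_over sc"
    and "unconditional_basis sc e"
    and "\<not> ergodic sc"
  shows "(\<forall>x y. in_residual_class sc e x \<longrightarrow> block_sequence sc e y \<longrightarrow>
            lin_isomorphic sc (closed_span sc x)
              (module_prod.scale sc sc) (closed_span sc x \<times> closed_span sc y)) \<and>
         (hereditarily_block_minimal sc e \<longrightarrow>
            (\<forall>y z u v. block_sequence sc e y \<longrightarrow> block_sequence sc e z \<longrightarrow>
               in_residual_class sc y u \<longrightarrow> in_residual_class sc z v \<longrightarrow>
               lin_isomorphic sc (closed_span sc u) sc (closed_span sc v)))"
proof -
  interpret banach_over sc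
    by (rule assms(1))
  obtain K where e: "uncond e K"
    by (rule unconditional_basis_uncond[OF assms(2)])
  show ?thesis
    unfolding closed_span_eq
    using residual_class_absorbs[OF e] residual_classes_isomorphic[OF e] by blast
qed

end
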